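(* Let $G$ be a graph with $\ell$ edges and no isolated vertices. For every integer $m\ge 3$, $$r(G,K_m)\le (2\ell+1)^{\frac{m-1}{2}}.$$
   Context: All graphs are finite and simple. $K_m$ is the complete graph on $m$ vertices. For graphs $G$ and $H$, the Ramsey number $r(G,H)$ is the smallest positive integer $N$ such that every red-blue coloring of the edges of the complete graph $K_N$ contains a red subgraph isomorphic to $G$ or a blue subgraph isomorphic to $H$ (subgraphs are not required to be induced). *)

theory Defs
  imports Complex_Main "HOL-Library.Ramsey"
begin

type_synonym 'a graph = "'a set \<times> 'a set set"

abbreviation verts :: "'a graph \<Rightarrow> 'a set"
  where "verts G \<equiv> fst G"

abbreviation edges :: "'a graph \<Rightarrow> 'a set set"
  where "edges G \<equiv> snd G"

definition finite_simple_graph :: "'a graph \<Rightarrow> bool"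
  where "finite_simple_graph G \<longleftrightarrow> finite (verts G) \<and> edges G \<subseteq> [verts G]\<^bsup>2\<^esup>"

definition isolated_vertex :: "'a graph \<Rightarrow> 'a \<Rightarrow> bool"
  where "isolated_vertex G v \<longleftrightarrow> v \<in> verts G \<and> (\<forall>e\<in>edges G. v \<notin> e)"

definition complete_graph :: "nat \<Rightarrow> nat graph"
  where "complete_graph m = ({..<m}, [{..<m}]\<^bsup>2\<^esup>)"

text \<open>Subgraphs are not required to be induced.\<close>

definition subgraph :: "'a graph \<Rightarrow> 'a graph \<Rightarrow> bool"
  where "subgraph H G \<longleftrightarrow>
    finite_simple_graph H \<and> verts H \<subseteq> verts G \<and> edges H \<subseteq> edges G"

definition isomorphic_graphs :: "'a graph \<Rightarrow> 'b graph \<Rightarrow> bool"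
  where "isomorphic_graphs G H \<longleftrightarrow>
    (\<exists>f. bij_betw f (verts G) (verts H) \<and>
         (\<forall>u\<in>verts G. \<forall>v\<in>verts G. {u, v} \<in> edges G \<longleftrightarrow> {f u, f v} \<in> edges H))"

datatype colour = Red | Blue

text \<open>
  A colouring is a total function on sets of vertices; only its values on the edges of the
  complete graph matter.
\<close>

definition colour_class :: "nat \<Rightarrow> (nat set \<Rightarrow> colour) \<Rightarrow> colour \<Rightarrow> nat graph"
  where "colour_class N c x =
    (verts (complete_graph N), {e \<in> edges (complete_graph N). c e = x})"

definition ramsey_property :: "'a graph \<Rightarrow> 'b graph \<Rightarrow> nat \<Rightarrow> bool"
  where "ramsey_property G H N \<longleftrightarrow>
    (\<forall>c :: nat set \<Rightarrow> colour.
       (\<exists>S. subgraph S (colour_class N c Red) \<and> isomorphic_graphs S G) \<or>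
       (\<exists>S. subgraph S (colour_class N c Blue) \<and> isomorphic_graphs S H))"

definition ramsey_number :: "'a graph \<Rightarrow> 'b graph \<Rightarrow> nat"
  where "ramsey_number G H = (LEAST N. N > 0 \<and> ramsey_property G H N)"

text \<open>
  By Ramsey's theorem the set of which \<open>ramsey_number\<close> takes the least element is nonempty, so
  \<open>ramsey_number\<close> is never an unspecified value on finite simple graphs.
\<close>

lemma clique_imp_subgraph_copy:
  fixes G :: "'a graph" and X :: "'b graph"
  assumes G: "finite_simple_graph G" and R: "R \<subseteq> verts X" "finite R" "card R = card (verts G)"
    and clq: "clique R (edges X)"
  shows "\<exists>S. subgraph S X \<and> isomorphic_graphs S G"
proof -
  have fG: "finite (verts G)" and eG: "edges G \<subseteq> [verts G]\<^bsup>2\<^esup>"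
    using G by (auto simp: finite_simple_graph_def)
  obtain f where f: "bij_betw f R (verts G)"
    using finite_same_card_bij[OF R(2) fG R(3)] by blast
  define S where "S = (R, {e \<in> [R]\<^bsup>2\<^esup>. f ` e \<in> edges G})"
  have "[R]\<^bsup>2\<^esup> \<subseteq> edges X"
    using clq by (auto simp: clique_def elim!: nsets2_E)
  then have "subgraph S X"
    using R by (auto simp: subgraph_def finite_simple_graph_def S_def)
  moreover have "{u, v} \<in> edges S \<longleftrightarrow> {f u, f v} \<in> edges G" if "u \<in> R" "v \<in> R" for u v
  proof -
    have "{f u, f v} \<in> edges G \<Longrightarrow> u \<noteq> v"
      using eG by (metis doubleton_in_nsets_2 subsetD)
    then show ?thesis
      using that by (auto simp: S_def)
  qed
  then have "isomorphic_graphs S G"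
    using f unfolding isomorphic_graphs_def by (intro exI[of _ f]) (simp add: S_def)
  ultimately show ?thesis by blast
qed

lemma ramsey_number_well_defined:
  fixes G :: "'a graph" and H :: "'b graph"
  assumes G: "finite_simple_graph G" and H: "finite_simple_graph H"
  shows "\<exists>N>0. ramsey_property G H N"
proof -
  obtain r where r: "r \<ge> 1" and ram: "\<And>(V::nat set) E. finite V \<Longrightarrow> card V \<ge> r \<Longrightarrow>
      \<exists>R\<subseteq>V. card R = card (verts G) \<and> clique R E \<or> card R = card (verts H) \<and> indep R E"
    using ramsey2[of "card (verts G)" "card (verts H)", where 'a = nat] by metis
  have "ramsey_property G H r"
    unfolding ramsey_property_def
  proof
    fix c :: "nat set \<Rightarrow> colour"
    obtain R where R: "R \<subseteq> {..<r}" and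
      cases: "card R = card (verts G) \<and> clique R (edges (colour_class r c Red)) \<or>
              card R = card (verts H) \<and> indep R (edges (colour_class r c Red))"
      using ram[of "{..<r}" "edges (colour_class r c Red)"] by auto
    have fR: "finite R" using R finite_subset by blast
    have V: "R \<subseteq> verts (colour_class r c x)" for x
      using R by (simp add: colour_class_def complete_graph_def)
    from cases show "(\<exists>S. subgraph S (colour_class r c Red) \<and> isomorphic_graphs S G) \<or>
      (\<exists>S. subgraph S (colour_class r c Blue) \<and> isomorphic_graphs S H)"
    proof
      assume "card R = card (verts G) \<and> clique R (edges (colour_class r c Red))"
      then show ?thesis
        using clique_imp_subgraph_copy[OF G V fR] by blast
    next
      assume *: "card R = card (verts H) \<and> indep R (edges (colour_class r c Red))"
      have "{v, w} \<in> edges (colour_class r c Blue)" if "v \<in> R" "w \<in> R" "v \<noteq> w" for v w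
      proof -
        have E: "{v, w} \<in> [{..<r}]\<^bsup>2\<^esup>"
          using R that by auto
        moreover have "{v, w} \<notin> edges (colour_class r c Red)"
          using * that by (simp add: indep_def)
        ultimately have "c {v, w} \<noteq> Red"
          by (simp add: colour_class_def complete_graph_def)
        then have "c {v, w} = Blue"
          by (cases "c {v, w}") simp_all
        with E show ?thesis
          by (simp add: colour_class_def complete_graph_def)
      qed
      then have "clique R (edges (colour_class r c Blue))"
        by (simp add: clique_def)
      then show ?thesis
        using * clique_imp_subgraph_copy[OF H V fR] by blast
    qed
  qed
  with r show ?thesis by (intro exI[of _ r]) simp
qed

lemma finite_simple_complete_graph: "finite_simple_graph (complete_graph m)"
  by (simp add: finite_simple_graph_def complete_graph_def)

end

theory Submission
  imports Defs
begin

text \<open>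
  Let \<open>n\<close> be the number of vertices of \<open>G\<close> (the guest) and colour the edges of a complete graph (the
  host) red and blue. The case \<open>m = 3\<close> is Sidorenko's bound \<open>r(G, K\<^sub>3) \<le> 2 l + 1\<close>, proved here as
  \<open>triangle_free_red_embedding\<close>; a greedy embedding then raises \<open>m\<close> one at a time
  (\<open>red_embedding_if_no_blue_clique\<close>).

  For the greedy step put \<open>s = sqrt (2 l + 1)\<close> and suppose that there is no blue \<open>K\<^bsub>m+1\<^esub>\<close>. Blue
  neighbourhoods contain no blue \<open>K\<^sub>m\<close>, so one with more than \<open>s\<^bsup>m-1\<^esup> - 1\<close> vertices contains a red
  \<open>G\<close> by induction. Otherwise order the guest so that every vertex has at most \<open>d\<close> earlier
  neighbours, where \<open>d\<close> is the degeneracy of \<open>G\<close>, and place the vertices one by one: each earlier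
  neighbour forbids at most \<open>s\<^bsup>m-1\<^esup> - 1\<close> host vertices. There is always room, because
  \<open>n + d\<^sup>2 \<le> 2 l + 1\<close> holds without isolated vertices (\<open>degeneracy_bound\<close>), and this makes
  \<open>n - d \<le> (s - d) s\<^bsup>m-1\<^esup>\<close>.

  For Sidorenko's bound let the blue graph be triangle-free, so that all blue neighbourhoods are red
  cliques, and let \<open>C\<close> be a largest one, of size \<open>b\<close>, belonging to the vertex \<open>x\<close>. If \<open>b \<ge> n\<close> then
  \<open>G\<close> fits into \<open>C\<close>. A disconnected guest is embedded part by part. Otherwise delete a vertex of
  minimum degree \<open>d\<close> and embed the rest by induction. If the deleted vertex cannot be put back, then
  counting the forbidden host vertices gives \<open>d t + ex + 2 \<le> n\<close> for \<open>t = n - b\<close> and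
  \<open>ex = 2 l - d n\<close>; in particular all but at most \<open>ex\<close> guest vertices have degree exactly \<open>d\<close>. This is
  the locale \<open>tight_case\<close>.

  There it suffices to place a set \<open>T\<close> of \<open>t\<close> vertices outside \<open>C\<close> and their remaining neighbours in
  \<open>C\<close>, as the other vertices can be thrown into the red clique \<open>C\<close> arbitrarily
  (\<open>placed_imp_embedding\<close>). A vertex of degree \<open>d\<close> of which one neighbour is still free has many
  possible positions outside \<open>C\<close> (\<open>card_choices\<close>). Hence only the last neighbour is critical. If it
  cannot be placed, then all its possible positions are blue to all possible positions of the
  vertex, and neither side of such a complete blue bipartite graph can exceed the largest blue
  degree \<open>b\<close>. Vertices of degree \<open>d\<close> all of whose neighbours are hubs, that is vertices of larger
  degree, are used first (\<open>hub_stage\<close>), then whole components of the graph induced on the vertices of degree \<open>d\<close> (\<open>tree_step\<close>). Both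
  stages use up vertices so slowly that the used-up vertices of degree \<open>d\<close> and the hubs together
  number at most \<open>d |T| + ex\<close>. Since \<open>n \<ge> d t + ex + 2\<close>, the supply lasts until \<open>|T| \<ge> t\<close>.
\<close>

section \<open>Guests, hosts and red embeddings\<close>

text \<open>
  \<open>B\<close> is the set of blue pairs. As \<open>f\<close> is injective, a pair that is not blue is a red edge.
\<close>

definition red_embedding :: "('a \<times> 'a) set \<Rightarrow> 'a set \<Rightarrow> ('b \<times> 'b) set \<Rightarrow> 'b set \<Rightarrow> ('a \<Rightarrow> 'b) \<Rightarrow> bool" where
  "red_embedding R V B W f \<longleftrightarrow>
     inj_on f V \<and> f ` V \<subseteq> W \<and> (\<forall>u\<in>V. \<forall>v\<in>V. (u, v) \<in> R \<longrightarrow> (f u, f v) \<notin> B)"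

definition blue_triangle_free :: "('b \<times> 'b) set \<Rightarrow> 'b set \<Rightarrow> bool" where
  "blue_triangle_free B W \<longleftrightarrow>
     (\<forall>x\<in>W. \<forall>y\<in>W. \<forall>z\<in>W. (x, y) \<in> B \<longrightarrow> (y, z) \<in> B \<longrightarrow> (x, z) \<notin> B)"

lemma ex_max_pair:
  fixes \<mu> :: "'a \<Rightarrow> nat"
  assumes "P a c" "\<And>a c. P a c \<Longrightarrow> \<mu> a \<le> N"
  obtains a c where "P a c" "\<And>a' c'. P a' c' \<Longrightarrow> \<mu> a' \<le> \<mu> a"
proof -
  have "\<exists>n. (\<exists>a c. P a c \<and> \<mu> a = n) \<and> (\<forall>n'. (\<exists>a c. P a c \<and> \<mu> a = n') \<longrightarrow> n' \<le> n)"
    by (rule Nat.ex_has_greatest_nat[of _ "\<mu> a" N]) (use assms in auto)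
  then show ?thesis using that by blast
qed

lemma extend_inj_on:
  assumes inj: "inj_on f X" and Z: "finite Z" and F: "finite F" "F \<inter> f ` X = {}"
    and le: "card (Z - X) \<le> card F"
  obtains g where "\<And>z. z \<in> X \<Longrightarrow> g z = f z" "inj_on g (X \<union> Z)" "g ` (Z - X) \<subseteq> F"
proof -
  obtain h where h: "h ` (Z - X) \<subseteq> F" "inj_on h (Z - X)"
    using card_le_inj[of "Z - X" F] Z F(1) le by auto
  define g where "g z = (if z \<in> X then f z else h z)" for z
  have gX: "g ` X = f ` X" "inj_on g X"
    using inj by (auto simp: g_def inj_on_def)
  have gZ: "g ` (Z - X) = h ` (Z - X)" "inj_on g (Z - X)"
    using h(2) by (auto simp: g_def inj_on_def)
  have disj: "g ` X \<inter> g ` (Z - X) = {}" using gX(1) gZ(1) h(1) F(2) by blast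
  have "inj_on g (X \<union> (Z - X))"
    using gX(2) gZ(2) disj unfolding inj_on_Un by blast
  then have "inj_on g (X \<union> Z)" by simp
  then show ?thesis
    using that[of g] gZ(1) h(1) by (simp add: g_def)
qed

lemma inj_on_fun_upd_insert:
  assumes "inj_on f X" "v \<notin> X" "y \<notin> f ` X"
  shows "inj_on (f(v := y)) (insert v X)"
  using assms by (auto simp: inj_on_def)

lemma card_relation_Times:
  assumes "finite A" "finite B"
  shows "card (R \<inter> A \<times> B) = (\<Sum>u\<in>A. card (R `` {u} \<inter> B))"
proof -
  have "R \<inter> A \<times> B = (SIGMA u:A. R `` {u} \<inter> B)" by auto
  then show ?thesis using assms by simp
qed

lemma card_relation_converse:
  assumes "sym R"
  shows "card (R \<inter> A \<times> B) = card (R \<inter> B \<times> A)"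
proof -
  have "R \<inter> B \<times> A = prod.swap ` (R \<inter> A \<times> B)"
    using assms by (force simp: sym_def image_iff)
  then show ?thesis by (simp add: card_image)
qed

text \<open>
  The guest is given by its set of ordered adjacent pairs, so that \<open>card R\<close> is twice the number
  of edges.
\<close>

locale guest =
  fixes R :: "('a \<times> 'a) set" and V :: "'a set"
  assumes finV: "finite V" and RV: "R \<subseteq> V \<times> V" and symR: "sym R" and irreflR: "irrefl R"
begin

abbreviation deg :: "'a \<Rightarrow> nat" where "deg v \<equiv> card (R `` {v})"

lemma adj_sym: "(u, v) \<in> R \<longleftrightarrow> (v, u) \<in> R"
  using symR by (auto simp: sym_def)

lemma not_adj_self [simp]: "(u, u) \<notin> R"
  using irreflR by (auto simp: irrefl_def)

lemma nbrs_subset: "R `` X \<subseteq> V" using RV by auto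

lemma fin_nbrs [simp]: "finite (R `` X)"
  using nbrs_subset finV finite_subset by blast

lemma fin_R: "finite R"
  using RV finV finite_subset by blast

lemma card_R_eq_sum_deg: "card R = (\<Sum>v\<in>V. deg v)"
proof -
  have "R \<inter> V \<times> V = R" "\<And>v. R `` {v} \<inter> V = R `` {v}" using RV by auto
  then show ?thesis using card_relation_Times[OF finV finV, of R] by (simp only:)
qed

lemma guest_restrict: "X \<subseteq> V \<Longrightarrow> guest (R \<inter> X \<times> X) X"
  using finV symR irreflR
  by (auto simp: guest_def sym_def irrefl_def intro: finite_subset)

end

locale host =
  fixes B :: "('b \<times> 'b) set" and W :: "'b set"
  assumes finW: "finite W" and symB: "sym B" and irreflB: "irrefl B"
begin

abbreviation bnb :: "'b \<Rightarrow> 'b set" where "bnb x \<equiv> B `` {x} \<inter> W"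

lemma blue_sym: "(x, y) \<in> B \<longleftrightarrow> (y, x) \<in> B"
  using symB by (auto simp: sym_def)

lemma not_blue_self [simp]: "(x, x) \<notin> B"
  using irreflB by (auto simp: irrefl_def)

lemma fin_bnb [simp]: "finite (bnb x)" using finW by simp

text \<open>
  The greedy step: \<open>Z\<close> are the positions of the neighbours of the next guest vertex, \<open>Y\<close> the
  occupied host vertices.
\<close>

lemma room_avoiding_blue:
  assumes "Z \<subseteq> W" and "\<And>z. z \<in> Z \<Longrightarrow> card (bnb z) \<le> c"
    and "finite Y" "card Y + c * card Z < card W"
  obtains y where "y \<in> W" "y \<notin> Y" "\<And>z. z \<in> Z \<Longrightarrow> (y, z) \<notin> B"
proof -
  have fZ: "finite Z" using assms(1) finW finite_subset by blast
  have "card ((Y \<inter> W) \<union> (\<Union>z\<in>Z. bnb z)) \<le> card (Y \<inter> W) + card (\<Union>z\<in>Z. bnb z)"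
    by (rule card_Un_le)
  also have "card (\<Union>z\<in>Z. bnb z) \<le> (\<Sum>z\<in>Z. card (bnb z))"
    by (rule card_UN_le[OF fZ])
  also have "\<dots> \<le> c * card Z"
    using sum_bounded_above[of Z "\<lambda>z. card (bnb z)" c] assms(2) by (simp add: mult.commute)
  also have "card (Y \<inter> W) + c * card Z < card W"
    using card_mono[OF assms(3), of "Y \<inter> W"] assms(4) by simp
  finally have "\<not> W \<subseteq> (Y \<inter> W) \<union> (\<Union>z\<in>Z. bnb z)"
    using card_mono[of "(Y \<inter> W) \<union> (\<Union>z\<in>Z. bnb z)" W] assms(3) finW fZ by fastforce
  then obtain y where "y \<in> W" "y \<notin> Y" "\<And>z. z \<in> Z \<Longrightarrow> (z, y) \<notin> B" by auto
  then show ?thesis using that blue_sym by blast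
qed

end

section \<open>The tight case of Sidorenko's induction\<close>

text \<open>
  Writing \<open>k + 1\<close> for the minimum degree avoids subtraction: \<open>k\<close> is the number of neighbours that
  are placed before a vertex of minimum degree when one neighbour is kept for last.
\<close>

locale tight_case = guest R V + host B W
  for R :: "('a \<times> 'a) set" and V :: "'a set" and B :: "('b \<times> 'b) set" and W :: "'b set" +
  fixes x :: 'b and k t ex b :: nat
  assumes tf: "blue_triangle_free B W"
    and k_pos: "1 \<le> k"
    and mindeg: "v \<in> V \<Longrightarrow> k + 1 \<le> deg v"
    and card_R: "card R = (k + 1) * card V + ex"
    and card_W: "card R < card W"
    and conn: "X \<subseteq> V \<Longrightarrow> X \<noteq> {} \<Longrightarrow> R `` X \<subseteq> X \<Longrightarrow> X = V"
    and x_W: "x \<in> W" and card_bnb_x: "card (bnb x) = b"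
    and bnb_le: "y \<in> W \<Longrightarrow> card (bnb y) \<le> b"
    and b_t: "b + t = card V" and t_pos: "1 \<le> t"
    and gap: "(k + 1) * t + ex + 2 \<le> card V"
begin

text \<open>
  \<open>H\<close> is the set of hubs. Every hub contributes at least 1 to the total excess \<open>ex\<close>, which is why
  there are few of them.
\<close>

definition "S = {v \<in> V. deg v = k + 1}"
definition "H = {v \<in> V. k + 1 < deg v}"
definition "C = bnb x"
definition "U = W - C - {x}"

definition excess :: "'a set \<Rightarrow> nat" where "excess X = (\<Sum>v\<in>X. deg v - (k + 1))"

lemma S_H: "S \<union> H = V" "S \<inter> H = {}"
  by (auto simp: S_def H_def dest: mindeg)

lemma fin_S [simp]: "finite S" and fin_H [simp]: "finite H"
  using finV by (auto simp: S_def H_def)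

lemma deg_S: "v \<in> S \<Longrightarrow> deg v = k + 1" by (simp add: S_def)

lemma card_S_H: "card S + card H = card V"
  using S_H card_Un_disjoint[of S H] by simp

lemma C_U: "C \<subseteq> W" "U \<subseteq> W" "C \<inter> U = {}" "x \<notin> U" "x \<notin> C"
  by (auto simp: C_def U_def)

lemma fin_C [simp]: "finite C" and fin_U [simp]: "finite U"
  using finW by (auto simp: C_def U_def)

lemma card_C: "card C = b" by (simp add: C_def card_bnb_x)

lemma C_red: "y \<in> C \<Longrightarrow> z \<in> C \<Longrightarrow> (y, z) \<notin> B"
  using tf x_W blue_sym by (auto simp: C_def blue_triangle_free_def)

lemma b_ge: "k * t + ex + 2 \<le> b"
  using gap b_t by (simp add: algebra_simps)

lemma card_U: "k * b + (k + 1) * t + ex \<le> card U"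
proof -
  have "card (W - C - {x}) = card W - b - 1"
    using C_U x_W by (simp add: card_Diff_subset card_C)
  moreover have "(k + 1) * card V = (k + 1) * b + (k + 1) * t"
    using b_t by (metis distrib_left)
  ultimately show ?thesis
    using card_W card_R by (simp add: U_def)
qed

lemma excess_split:
  assumes "X \<subseteq> Y" "finite Y"
  shows "excess Y = excess X + excess (Y - X)"
  unfolding excess_def using sum.subset_diff[OF assms, of "\<lambda>v. deg v - (k + 1)"] by simp

lemma sum_deg_eq:
  assumes "X \<subseteq> V"
  shows "(\<Sum>v\<in>X. deg v) = (k + 1) * card X + excess X"
proof -
  have "deg v = (k + 1) + (deg v - (k + 1))" if "v \<in> X" for v
    using mindeg[of v] that assms by auto
  then have "(\<Sum>v\<in>X. deg v) = (\<Sum>v\<in>X. (k + 1) + (deg v - (k + 1)))"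
    by (rule sum.cong[OF refl])
  then show ?thesis unfolding excess_def by (simp only: sum.distrib) simp
qed

lemma card_le_excess:
  assumes "X \<subseteq> H"
  shows "card X \<le> excess X"
proof -
  have "(\<Sum>v\<in>X. 1) \<le> (\<Sum>v\<in>X. deg v - (k + 1))"
    using assms by (intro sum_mono) (auto simp: H_def)
  then show ?thesis by (simp add: excess_def)
qed

lemma excess_H: "excess H \<le> ex"
proof -
  have "excess V = ex" using sum_deg_eq[of V] card_R card_R_eq_sum_deg by simp
  moreover have "H \<subseteq> V" using S_H by blast
  ultimately show ?thesis using excess_split[of H V] finV by simp
qed

lemma card_H: "card H \<le> ex"
  using card_le_excess[of H] excess_H by simp

text \<open>
  The positions outside \<open>C\<close> for a vertex whose placed neighbours sit in \<open>Z\<close> when \<open>X\<close> is occupied.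
\<close>

definition choices :: "'b set \<Rightarrow> 'b set \<Rightarrow> 'b set" where
  "choices Z X = {y \<in> U - X. \<forall>z\<in>Z. (y, z) \<notin> B}"

text \<open>
  A vertex of \<open>C\<close> is blue to \<open>x\<close>, hence to at most \<open>b - 1\<close> vertices of \<open>U\<close>, whereas a vertex of \<open>U\<close>
  may lose one more; this is the reason for the term \<open>card (Z \<inter> U)\<close>.
\<close>

lemma card_choices:
  assumes Z: "Z \<subseteq> C \<union> U" "card Z \<le> k" and X: "finite X" "card X < t"
  shows "k * t + ex + k + 1 \<le> card (choices Z X) + card (Z \<inter> U)"
proof -
  have fZ: "finite Z" using finite_subset[OF Z(1)] by simp
  define D where "D = (\<Union>z\<in>Z. bnb z \<inter> U)"
  have each: "card (bnb z \<inter> U) + 1 \<le> b + (if z \<in> U then 1 else 0)" if "z \<in> Z" for z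
  proof (cases "z \<in> U")
    case True
    then have "card (bnb z \<inter> U) \<le> card (bnb z)" by (intro card_mono) auto
    then show ?thesis using True bnb_le[of z] C_U by auto
  next
    case False
    then have zC: "z \<in> C" using that Z by auto
    then have "insert x (bnb z \<inter> U) \<subseteq> bnb z"
      using x_W blue_sym[of x z] by (auto simp: C_def)
    then have "card (insert x (bnb z \<inter> U)) \<le> card (bnb z)" by (intro card_mono) auto
    moreover have "card (insert x (bnb z \<inter> U)) = card (bnb z \<inter> U) + 1" using C_U by simp
    ultimately show ?thesis using False bnb_le[of z] zC C_U by auto
  qed
  have "card D \<le> (\<Sum>z\<in>Z. card (bnb z \<inter> U))"
    unfolding D_def by (rule card_UN_le[OF fZ])
  then have "card D + card Z \<le> (\<Sum>z\<in>Z. card (bnb z \<inter> U) + 1)"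
    by (simp only: sum.distrib) simp
  also have "\<dots> \<le> (\<Sum>z\<in>Z. b + (if z \<in> U then 1 else 0))"
    using each by (rule sum_mono)
  also have "\<dots> = card Z * b + card (Z \<inter> U)"
    using fZ by (simp only: sum.distrib) (simp add: sum.If_cases)
  finally have D: "card D + card Z \<le> card Z * b + card (Z \<inter> U)" .
  have "card U \<le> card (choices Z X \<union> X \<union> D)"
  proof (rule card_mono)
    show "finite (choices Z X \<union> X \<union> D)" using fZ X by (auto simp: choices_def D_def)
    show "U \<subseteq> choices Z X \<union> X \<union> D" using C_U blue_sym by (fastforce simp: choices_def D_def)
  qed
  also have "\<dots> \<le> card (choices Z X) + card X + card D"
    by (meson add_right_mono card_Un_le le_trans)
  finally have U: "card U \<le> card (choices Z X) + card X + card D" .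
  obtain b' where b': "b = Suc b'" using b_ge by (cases b) auto
  have "card Z * b' \<le> k * b'" using Z(2) by simp
  moreover have "card Z * b = card Z * b' + card Z" "k * b = k * b' + k" "(k + 1) * t = k * t + t"
    by (simp_all add: b')
  ultimately show ?thesis using D U X(2) card_U by linarith
qed

text \<open>
  A partial embedding: \<open>T\<close> goes outside \<open>C\<close>, the neighbours of \<open>T\<close> that do not belong to \<open>T\<close> go
  into \<open>C\<close>.
\<close>

definition placed :: "'a set \<Rightarrow> ('a \<Rightarrow> 'b) \<Rightarrow> bool" where
  "placed T f \<longleftrightarrow> T \<subseteq> V \<and> inj_on f (T \<union> R `` T) \<and> f ` T \<subseteq> U \<and> f ` (R `` T - T) \<subseteq> C \<and>
     (\<forall>u\<in>T. \<forall>v\<in>R `` {u}. (f u, f v) \<notin> B)"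

text \<open>
  The vertices still to be placed are not adjacent to \<open>T\<close>, so all their edges will lie inside the
  red clique \<open>C\<close>; if \<open>T\<close> has \<open>t\<close> elements, then \<open>C\<close> is large enough for them.
\<close>

lemma placed_imp_embedding:
  assumes p: "placed T f" and T: "t \<le> card T"
  shows "\<exists>h. red_embedding R V B W h"
proof -
  have TV: "T \<subseteq> V" and inj: "inj_on f (T \<union> R `` T)" and fT: "f ` T \<subseteq> U"
    and fN: "f ` (R `` T - T) \<subseteq> C" and edge: "\<And>u v. u \<in> T \<Longrightarrow> (u, v) \<in> R \<Longrightarrow> (f u, f v) \<notin> B"
    using p by (auto simp: placed_def)
  have finT: "finite T" using TV finV finite_subset by blast
  define X where "X = T \<union> R `` T"
  define F where "F = C - f ` (R `` T - T)"
  have XV: "X \<subseteq> V" using TV nbrs_subset by (auto simp: X_def)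
  have cF: "card F = b - card (R `` T - T)"
  proof -
    have "card (f ` (R `` T - T)) = card (R `` T - T)"
      by (rule card_image) (use inj in \<open>auto intro: inj_on_subset\<close>)
    then show ?thesis unfolding F_def using fN by (simp add: card_Diff_subset card_C)
  qed
  have "card (V - X) = card V - card X" using XV finV by (simp add: card_Diff_subset finite_subset)
  moreover have "card X = card T + card (R `` T - T)"
    unfolding X_def using finT by (subst card_Un_disjoint[symmetric]) (auto intro: arg_cong[where f = card])
  ultimately have le: "card (V - X) \<le> card F" using cF T b_t by simp
  have disj: "F \<inter> f ` X = {}" using fT C_U(3) unfolding F_def X_def by blast
  have "inj_on f X" "finite F" using inj by (auto simp: X_def F_def)
  then obtain h where h: "\<And>z. z \<in> X \<Longrightarrow> h z = f z" "inj_on h (X \<union> V)" "h ` (V - X) \<subseteq> F"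
    using extend_inj_on[OF _ finV _ disj le] by blast
  have hC: "h v \<in> C" if "v \<in> V" "v \<notin> T" for v
  proof (cases "v \<in> X")
    case True
    then have "v \<in> R `` T - T" using that by (auto simp: X_def)
    then show ?thesis using h(1)[OF True] fN by auto
  next
    case False
    then show ?thesis using that h(3) by (auto simp: F_def)
  qed
  have hT: "h v \<in> U" "h v = f v" if "v \<in> T" for v
    using that h(1)[of v] fT by (auto simp: X_def)
  have e1: "(h u, h v) \<notin> B" if "u \<in> T" "(u, v) \<in> R" for u v
  proof -
    have "u \<in> X" "v \<in> X" using that by (auto simp: X_def)
    then show ?thesis using edge[OF that] h(1) by simp
  qed
  have "(h u, h v) \<notin> B" if "u \<in> V" "v \<in> V" "(u, v) \<in> R" for u v
    using e1[of u v] e1[of v u] that adj_sym[of u v] blue_sym[of "h u" "h v"] hC[of u] hC[of v] C_red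
    by metis
  moreover have "h ` V \<subseteq> W" using hC hT C_U by blast
  moreover have "inj_on h V" using h(2) inj_on_subset by blast
  ultimately show ?thesis unfolding red_embedding_def by blast
qed

subsection \<open>Vertices with only hub neighbours\<close>

definition "S\<^sub>1 = {v \<in> S. R `` {v} \<subseteq> H}"

text \<open>
  The set \<open>A\<close> of unused vertices of \<open>C\<close> is kept for the hubs that are not yet adjacent to \<open>T\<close>, and
  \<open>E\<close> is a set completely joined to \<open>A\<close> in blue. A failed placement turns into a larger \<open>E\<close>, at the
  cost of removing at most \<open>k t\<close> vertices from \<open>A\<close>. As a vertex of \<open>A\<close> has blue degree at most \<open>b\<close>,
  \<open>E\<close> can grow only while \<open>card E + (k t + ex + k + 1) < b\<close>; the last condition makes \<open>A\<close> large
  enough to survive the loss in that case.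
\<close>

definition reserve :: "'a set \<Rightarrow> ('a \<Rightarrow> 'b) \<Rightarrow> 'b set \<Rightarrow> 'b set \<Rightarrow> bool" where
  "reserve T f A E \<longleftrightarrow> A \<subseteq> C - f ` (R `` T) \<and> E \<subseteq> U \<and> A \<times> E \<subseteq> B \<and> card (H - R `` T) \<le> card A \<and>
     (card E + (k * t + ex + k + 1) < b \<longrightarrow>
        b + card (H - R `` T) + k * t \<le> card A + card E + (k * t + ex + k + 1))"

text \<open>
  \<open>Q\<close> is placed in addition to \<open>T\<close>, as part of a component of the bipartite graph between \<open>S\<^sub>1\<close> and the
  hubs that \<open>T\<close> does not meet. The first vertex brings \<open>k + 1\<close> hubs, each further one shares a hub
  with its predecessors and brings at most \<open>k\<close>; hence the bound \<open>k * card Q + 1\<close>.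
\<close>

definition piece :: "'a set \<Rightarrow> ('a \<Rightarrow> 'b) \<Rightarrow> 'b set \<Rightarrow> 'a set \<Rightarrow> ('a \<Rightarrow> 'b) \<Rightarrow> bool" where
  "piece T f A Q h \<longleftrightarrow> Q \<subseteq> S\<^sub>1 \<and> placed (T \<union> Q) h \<and> (\<forall>z\<in>T \<union> R `` T. h z = f z) \<and>
     R `` Q \<inter> R `` T = {} \<and> h ` (R `` Q) \<subseteq> A \<and> (Q \<noteq> {} \<longrightarrow> card (R `` Q) \<le> k * card Q + 1)"

lemma S1_subset: "S\<^sub>1 \<subseteq> S" and nbrs_S1: "X \<subseteq> S\<^sub>1 \<Longrightarrow> R `` X \<subseteq> H"
  by (auto simp: S\<^sub>1_def)

lemma fin_S1 [simp]: "finite S\<^sub>1" using finite_subset[OF S1_subset] by simp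

text \<open>
  All neighbours of \<open>v\<close> but one, \<open>w\<close>, are placed in \<open>A\<close>. If no free \<open>a \<in> A\<close> is red to a possible
  position \<open>y \<in> Y\<close> of \<open>v\<close>, then the free part \<open>A'\<close> of \<open>A\<close> is completely blue to \<open>E \<union> Y\<close>. Since \<open>Y\<close>
  is red to a vertex of \<open>A\<close> to which \<open>E\<close> is blue, \<open>Y\<close> is disjoint from \<open>E\<close>, and \<open>(A', E \<union> Y)\<close>
  contradicts the maximality of \<open>E\<close>.
\<close>

lemma piece_extend:
  assumes T: "T \<subseteq> S\<^sub>1" and room: "reserve T f A E"
    and max: "\<And>A' E'. reserve T f A' E' \<Longrightarrow> card E' \<le> card E"
    and piece: "piece T f A Q h"
    and v: "v \<in> S\<^sub>1" "\<not> R `` {v} \<subseteq> R `` Q" "R `` {v} \<inter> R `` T = {}"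
    and touch: "Q = {} \<or> R `` {v} \<inter> R `` Q \<noteq> {}"
    and small: "card (T \<union> Q) < t"
  shows "\<exists>h'. piece T f A (insert v Q) h'"
proof -
  have Q: "Q \<subseteq> S\<^sub>1" and pl: "placed (T \<union> Q) h" and agree: "\<And>z. z \<in> T \<union> R `` T \<Longrightarrow> h z = f z"
    and dj: "R `` Q \<inter> R `` T = {}" and hA: "h ` (R `` Q) \<subseteq> A"
    and cQ: "Q \<noteq> {} \<Longrightarrow> card (R `` Q) \<le> k * card Q + 1"
    using piece by (auto simp: piece_def)
  have A: "A \<subseteq> C - f ` (R `` T)" and E: "E \<subseteq> U" and AE: "A \<times> E \<subseteq> B"
    and cA: "card (H - R `` T) \<le> card A"
    and cAE: "card E + (k * t + ex + k + 1) < b \<Longrightarrow>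
        b + card (H - R `` T) + k * t \<le> card A + card E + (k * t + ex + k + 1)"
    using room by (auto simp: reserve_def)
  have finA [simp]: "finite A" using finite_subset[OF A] by simp
  have finE [simp]: "finite E" using finite_subset[OF E] by simp
  have fTQ: "finite T" "finite Q" using T Q finite_subset[OF _ fin_S1] by auto
  define X where "X = T \<union> Q \<union> R `` (T \<union> Q)"
  have inj: "inj_on h X" and hT: "h ` (T \<union> Q) \<subseteq> U"
    and edge: "\<And>u z. u \<in> T \<union> Q \<Longrightarrow> (u, z) \<in> R \<Longrightarrow> (h u, h z) \<notin> B"
    using pl by (auto simp: placed_def X_def)
  have TQ_S: "T \<union> Q \<subseteq> S" and N_H: "R `` (T \<union> Q) \<subseteq> H" and vS: "v \<in> S" and Nv_H: "R `` {v} \<subseteq> H"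
    using T Q v S1_subset nbrs_S1[of "T \<union> Q"] nbrs_S1[of "{v}"] by auto
  have degv: "card (R `` {v}) = k + 1" using vS by (rule deg_S)
  obtain w where w: "w \<in> R `` {v}" "w \<notin> R `` Q" using v(2) by blast
  have v_new: "v \<notin> T" "v \<notin> Q" using w v(3) by auto
  have v_X: "v \<notin> X" using v_new N_H vS S_H by (auto simp: X_def)
  have w_X: "w \<notin> X" using w v(3) Nv_H TQ_S S_H by (auto simp: X_def)
  have vw: "v \<noteq> w" using w by auto
  define new where "new = R `` {v} - R `` Q - {w}"
  have fin_new [simp]: "finite new" by (simp add: new_def)
  have new_X: "new \<inter> X = {}" using v(3) Nv_H TQ_S S_H by (auto simp: new_def X_def)
  have new_H: "new \<subseteq> H - R `` T" using Nv_H v(3) by (auto simp: new_def)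
  define p where "p = card (R `` Q) + card new"
  have p_eq: "p = card (R `` Q \<union> new)"
    unfolding p_def by (rule card_Un_disjoint[symmetric]) (auto simp: new_def)
  have "insert w (R `` Q \<union> new) \<subseteq> H - R `` T"
    using N_H new_H w Nv_H v(3) dj by auto
  then have "card (insert w (R `` Q \<union> new)) \<le> card (H - R `` T)" by (intro card_mono) auto
  moreover have "card (insert w (R `` Q \<union> new)) = p + 1"
    using w by (simp add: p_eq new_def)
  ultimately have p_m: "p + 1 \<le> card (H - R `` T)" by simp
  have p_le: "p \<le> k * (card Q + 1)"
  proof -
    have w_new: "w \<notin> new" by (simp add: new_def)
    have new_le: "card (insert w new \<union> (R `` {v} \<inter> R `` Q)) \<le> card (R `` {v})"
      using w by (intro card_mono) (auto simp: new_def)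
    have "card (insert w new \<union> (R `` {v} \<inter> R `` Q)) = card (insert w new) + card (R `` {v} \<inter> R `` Q)"
      using w by (intro card_Un_disjoint) (auto simp: new_def)
    then have new_le: "card new + 1 + card (R `` {v} \<inter> R `` Q) \<le> k + 1"
      using new_le degv w_new by simp
    show ?thesis
    proof (cases "Q = {}")
      case True
      then show ?thesis using new_le by (simp add: p_def)
    next
      case False
      then have "0 < card (R `` {v} \<inter> R `` Q)" using touch by (simp add: card_gt_0_iff)
      then show ?thesis using new_le cQ[OF False] unfolding p_def by simp
    qed
  qed
  have p_kt: "p \<le> k * t"
  proof -
    have "card Q \<le> card (T \<union> Q)" using fTQ by (intro card_mono) auto
    then have "k * (card Q + 1) \<le> k * t" using small by (intro mult_le_mono) auto
    with p_le show ?thesis by linarith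
  qed
  define F where "F = A - h ` (R `` Q)"
  have hN: "h ` (R `` T) = f ` (R `` T)" by (intro image_cong refl agree) blast
  have hA_C: "h ` (R `` (T \<union> Q)) \<subseteq> C"
  proof -
    have "R `` (T \<union> Q) - (T \<union> Q) = R `` (T \<union> Q)" using N_H TQ_S S_H(2) by blast
    then show ?thesis using pl unfolding placed_def by simp
  qed
  have F_X: "F \<inter> h ` X = {}"
  proof -
    have "h ` X = h ` (T \<union> Q) \<union> f ` (R `` T) \<union> h ` (R `` Q)"
      unfolding X_def hN[symmetric] by blast
    then show ?thesis using hT A C_U(3) unfolding F_def by blast
  qed
  have cF: "card F = card A - card (R `` Q)"
  proof -
    have "card (h ` (R `` Q)) = card (R `` Q)"
      by (rule card_image) (rule inj_on_subset[OF inj], auto simp: X_def)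
    then show ?thesis unfolding F_def using hA by (simp add: card_Diff_subset)
  qed
  have "card (new - X) \<le> card new" by (rule card_mono) auto
  then have "card (new - X) \<le> card F" using cF p_m cA by (simp add: p_def)
  then obtain g where g: "\<And>z. z \<in> X \<Longrightarrow> g z = h z" "inj_on g (X \<union> new)" "g ` (new - X) \<subseteq> F"
    using extend_inj_on[OF inj fin_new _ F_X] by (auto simp: F_def)
  have gnew: "g ` new \<subseteq> F" using g(3) new_X by (metis Diff_triv)
  have gX: "g ` Z = h ` Z" if "Z \<subseteq> X" for Z
    using that by (intro image_cong refl g(1)) blast
  have gQ: "g ` (R `` Q) = h ` (R `` Q)" "g ` (T \<union> Q) = h ` (T \<union> Q)"
    by (auto simp: X_def intro!: gX)
  define N where "N = R `` {v} - {w}"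
  have N_sub: "N \<subseteq> R `` Q \<union> new" by (auto simp: N_def new_def)
  have gN_A: "g ` N \<subseteq> A" using N_sub gnew gQ(1) hA unfolding F_def by blast
  have cN: "card N = k" using w degv by (simp add: N_def)
  define Y where "Y = choices (g ` N) (g ` (T \<union> Q))"
  have cY: "k * t + ex + k + 1 \<le> card Y"
  proof -
    have fN: "finite N" by (simp add: N_def)
    have "card (g ` N) \<le> k" using card_image_le[OF fN, of g] cN by simp
    moreover have "card (g ` (T \<union> Q)) < t" using card_image_le[of "T \<union> Q" g] fTQ small by simp
    moreover have "g ` N \<inter> U = {}" using gN_A A C_U(3) by blast
    moreover have "g ` N \<subseteq> C \<union> U" using gN_A A by blast
    ultimately show ?thesis using card_choices[of "g ` N" "g ` (T \<union> Q)"] fTQ by (simp add: Y_def)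
  qed
  have Y_U: "Y \<subseteq> U" and Y_fresh: "Y \<inter> g ` (T \<union> Q) = {}"
    and Y_red: "\<And>y z. y \<in> Y \<Longrightarrow> z \<in> N \<Longrightarrow> (y, g z) \<notin> B"
    by (auto simp: Y_def choices_def)
  have finY [simp]: "finite Y" using finite_subset[OF Y_U] by simp
  define A' where "A' = A - g ` (R `` Q \<union> new)"
  have gp: "card (g ` (R `` Q \<union> new)) = p" "g ` (R `` Q \<union> new) \<subseteq> A"
  proof -
    show "card (g ` (R `` Q \<union> new)) = p"
      unfolding p_eq by (rule card_image) (rule inj_on_subset[OF g(2)], auto simp: X_def)
    show "g ` (R `` Q \<union> new) \<subseteq> A" unfolding image_Un gQ(1) using hA gnew unfolding F_def by blast
  qed
  have cA': "card A' = card A - p"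
    unfolding A'_def using gp by (simp add: card_Diff_subset)
  have A'_fresh: "A' \<inter> g ` (X \<union> new) = {}"
  proof -
    have "g ` (X \<union> new) = h ` X \<union> g ` new" unfolding image_Un gX[OF subset_refl] ..
    then show ?thesis using F_X unfolding A'_def image_Un gQ(1) F_def by blast
  qed
  have A'_ne: "A' \<noteq> {}" using cA' p_m cA by auto
  show ?thesis
  proof (cases "\<exists>a\<in>A'. \<exists>y\<in>Y. (a, y) \<notin> B")
    case True
    then obtain a y where a: "a \<in> A'" and y: "y \<in> Y" and ay: "(a, y) \<notin> B" by blast
    define h' where "h' = g(w := a, v := y)"
    have aC: "a \<in> C" "a \<in> A" using a A by (auto simp: A'_def)
    have yU: "y \<in> U" using y Y_U by blast
    have h'X: "h' z = g z" if "z \<in> X \<union> new" for z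
      using that v_X w_X Nv_H vS S_H by (auto simp: h'_def new_def)
    have h'v: "h' v = y" "h' w = a" using vw by (auto simp: h'_def)
    have NQ: "R `` insert v Q = R `` Q \<union> new \<union> {w}"
      using w by (auto simp: new_def)
    have NTQ: "R `` (T \<union> insert v Q) = R `` (T \<union> Q) \<union> new \<union> {w}"
      by (simp only: Image_Un NQ Un_assoc)
    have dom: "T \<union> insert v Q \<union> R `` (T \<union> insert v Q) = insert v (insert w (X \<union> new))"
    proof -
      have "T \<union> insert v Q \<union> (M \<union> new \<union> {w}) = insert v (insert w (T \<union> Q \<union> M \<union> new))" for M
        by blast
      then show ?thesis unfolding NTQ X_def .
    qed
    have new_v: "v \<notin> new" "w \<notin> new" using Nv_H vS S_H by (auto simp: new_def)
    have y_fresh: "y \<notin> g ` (X \<union> new)" "y \<noteq> a"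
    proof -
      have eq: "g ` (X \<union> new) = g ` (T \<union> Q) \<union> h ` (R `` (T \<union> Q)) \<union> g ` new"
        unfolding image_Un gX[OF subset_refl] unfolding X_def image_Un gQ(2)[unfolded image_Un] ..
      show "y \<notin> g ` (X \<union> new)"
      proof -
        have "y \<notin> C" using yU C_U(3) by blast
        moreover have "g ` new \<subseteq> C" using gnew A unfolding F_def by blast
        moreover have "y \<notin> g ` (T \<union> Q)" using Y_fresh y by blast
        ultimately show ?thesis using eq hA_C by (simp only: Un_iff) blast
      qed
      show "y \<noteq> a" using yU aC C_U(3) by blast
    qed
    have "inj_on (g(w := a)) (insert w (X \<union> new))"
      using inj_on_fun_upd_insert[OF g(2), of w a] w_X new_v A'_fresh a by blast
    then have inj': "inj_on h' (insert v (insert w (X \<union> new)))"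
      unfolding h'_def
    proof (rule inj_on_fun_upd_insert)
      show "v \<notin> insert w (X \<union> new)" using v_X new_v vw by blast
      show "y \<notin> (g(w := a)) ` insert w (X \<union> new)" using y_fresh by (auto simp: image_iff)
    qed
    have imT: "h' ` (T \<union> insert v Q) \<subseteq> U"
    proof -
      have "h' ` (T \<union> Q) = g ` (T \<union> Q)" by (intro image_cong refl h'X) (auto simp: X_def)
      then have "h' ` (T \<union> Q) = h ` (T \<union> Q)" by (simp only: gQ(2))
      then show ?thesis using hT yU h'v by auto
    qed
    have imQ: "h' ` (R `` insert v Q) \<subseteq> A"
    proof -
      have "h' ` (R `` Q \<union> new) = g ` (R `` Q \<union> new)"
        by (intro image_cong refl h'X) (auto simp: X_def)
      then show ?thesis unfolding NQ image_Un using gp(2) h'v aC by auto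
    qed
    have agree': "h' z = f z" if "z \<in> T \<union> R `` T" for z
    proof -
      have "z \<in> X" using that by (auto simp: X_def)
      then show ?thesis using h'X[of z] g(1)[of z] agree[OF that] by simp
    qed
    have imN: "h' ` (R `` (T \<union> insert v Q)) \<subseteq> C"
    proof -
      have "h' ` (R `` T) = f ` (R `` T)" by (intro image_cong refl agree') blast
      also have "\<dots> \<subseteq> C" using hA_C unfolding hN[symmetric] by blast
      finally have "h' ` (R `` T) \<subseteq> C" .
      moreover have "R `` (T \<union> insert v Q) = R `` T \<union> R `` insert v Q" by blast
      ultimately show ?thesis using imQ A by blast
    qed
    have edge': "(h' u, h' z) \<notin> B" if "u \<in> T \<union> insert v Q" "(u, z) \<in> R" for u z
    proof (cases "u = v")
      case True
      show ?thesis
      proof (cases "z = w")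
        case True
        then show ?thesis using \<open>u = v\<close> h'v ay blue_sym[of y a] by simp
      next
        case False
        then have zN: "z \<in> N" using that \<open>u = v\<close> by (auto simp: N_def)
        then have "h' z = g z" using N_sub h'X[of z] by (auto simp: X_def)
        then show ?thesis using Y_red[OF y zN] h'v \<open>u = v\<close> by simp
      qed
    next
      case False
      then have u: "u \<in> T \<union> Q" using that by blast
      then have "u \<in> X" "z \<in> X" using that by (auto simp: X_def)
      then show ?thesis using edge[OF u that(2)] h'X g(1) by simp
    qed
    have TV: "T \<union> insert v Q \<subseteq> V" using TQ_S vS S_H by auto
    have pl': "placed (T \<union> insert v Q) h'"
      unfolding placed_def
    proof (intro conjI ballI)
      show "inj_on h' (T \<union> insert v Q \<union> R `` (T \<union> insert v Q))" unfolding dom by (rule inj')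
      show "h' ` (R `` (T \<union> insert v Q) - (T \<union> insert v Q)) \<subseteq> C"
        by (rule order_trans[OF image_mono imN]) (rule Diff_subset)
    qed (use TV imT edge' in \<open>simp_all only: Image_singleton_iff not_False_eq_True\<close>)
    have "card (R `` insert v Q) \<le> k * card (insert v Q) + 1"
    proof -
      have "card (R `` insert v Q) = p + 1"
        unfolding NQ using w p_eq by (simp add: new_def)
      then show ?thesis using p_le v_new fTQ by simp
    qed
    moreover have "R `` insert v Q \<inter> R `` T = {}" using dj v(3) by blast
    ultimately have "piece T f A (insert v Q) h'"
      unfolding piece_def using v(1) Q pl' agree' imQ by simp
    then show ?thesis by blast
  next
    case False
    then have A'Y: "A' \<times> Y \<subseteq> B" by blast
    have "N \<noteq> {}" using cN k_pos by auto
    then obtain z where z: "z \<in> N" by blast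
    have EY: "E \<inter> Y = {}"
    proof -
      have "(g z, e) \<in> B" if "e \<in> E" for e using AE gN_A z that by blast
      then show ?thesis using Y_red[OF _ z] blue_sym by blast
    qed
    have cEY: "card (E \<union> Y) = card E + card Y" using EY by (simp add: card_Un_disjoint)
    obtain a where a: "a \<in> A'" using A'_ne by blast
    have aC: "a \<in> C" using a A by (auto simp: A'_def)
    have "(a, e) \<in> B" if "e \<in> E \<union> Y" for e
      using that a AE A'Y unfolding A'_def by blast
    moreover have "(a, x) \<in> B" using aC blue_sym[of a x] by (simp add: C_def)
    ultimately have "insert x (E \<union> Y) \<subseteq> bnb a" using E Y_U C_U(2) x_W by blast
    then have "card (insert x (E \<union> Y)) \<le> card (bnb a)" by (rule card_mono[OF fin_bnb])
    moreover have "card (insert x (E \<union> Y)) = card (E \<union> Y) + 1"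
      using E Y_U C_U by (subst card_insert_disjoint) auto
    ultimately have "card E + card Y < b" using bnb_le[of a] aC C_U cEY by auto
    then have "b + card (H - R `` T) + k * t \<le> card A + card E + (k * t + ex + k + 1)"
      using cAE cY by simp
    then have "card (H - R `` T) \<le> card A'"
      "b + card (H - R `` T) + k * t \<le> card A' + card (E \<union> Y) + (k * t + ex + k + 1)"
      using cA' p_kt cY cEY \<open>card E + card Y < b\<close> by linarith+
    moreover have "A' \<times> (E \<union> Y) \<subseteq> B" "A' \<subseteq> C - f ` (R `` T)" "E \<union> Y \<subseteq> U"
      using AE A'Y A E Y_U unfolding A'_def by blast+
    ultimately have "reserve T f A' (E \<union> Y)" unfolding reserve_def by blast
    then have "card (E \<union> Y) \<le> card E" by (rule max)
    then show ?thesis using cEY cY by simp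
  qed
qed

text \<open>
  The arithmetic behind the gain of a finished piece with \<open>s\<close> vertices of \<open>S\<^sub>1\<close>, \<open>h\<close> hubs of total
  excess \<open>e\<close> and \<open>r\<close> placed vertices. The first premise counts the edges at the hubs of the piece and
  is strict when one of them leaves the piece; otherwise the lemma is applied with \<open>e + 1\<close>.
\<close>

lemma piece_count:
  fixes s h e r :: nat
  assumes "(k + 1) * s < (k + 1) * h + e" and h: "h \<le> k * r + 1" "h \<le> e" and r: "1 \<le> r"
  shows "s + h \<le> (k + 1) * r + e"
proof (rule ccontr)
  assume "\<not> ?thesis"
  obtain c where c: "e = h + c" using h(2) le_Suc_ex by blast
  with \<open>\<not> ?thesis\<close> have "(k + 1) * r + c + 1 \<le> s" by simp
  then have "(k + 1) * ((k + 1) * r + c + 1) \<le> (k + 1) * s" by (rule mult_le_mono2)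
  moreover have "(k + 2) * h \<le> (k + 2) * (k * r + 1)" using h(1) by (rule mult_le_mono2)
  moreover have "(k + 1) * h + e = (k + 2) * h + c" by (simp add: c algebra_simps)
  moreover have "(k + 1) * ((k + 1) * r + c + 1) + 1 = (k + 2) * (k * r + 1) + r + k * c + c"
    by (simp add: algebra_simps)
  ultimately show False using assms(1) r by linarith
qed

text \<open>
  The pieces are completed one after the other, so the hubs adjacent to \<open>T\<close> form a union of
  components of the bipartite graph between \<open>S\<^sub>1\<close> and \<open>H\<close>.
\<close>

definition hub_state :: "'a set \<Rightarrow> ('a \<Rightarrow> 'b) \<Rightarrow> bool" where
  "hub_state T f \<longleftrightarrow> placed T f \<and> T \<subseteq> S\<^sub>1 \<and>
     (\<forall>v\<in>S\<^sub>1. R `` {v} \<subseteq> R `` T \<or> R `` {v} \<inter> R `` T = {}) \<and>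
     card {v \<in> S\<^sub>1. R `` {v} \<subseteq> R `` T} + card (R `` T) \<le> (k + 1) * card T + excess (R `` T) \<and>
     (\<exists>A E. reserve T f A E)"

lemma nbrs_S1_nonempty: "v \<in> S\<^sub>1 \<Longrightarrow> R `` {v} \<noteq> {}"
  using deg_S[of v] S1_subset by (metis Suc_eq_plus1 card.empty nat.distinct(1) subsetD)

text \<open>
  A maximal piece, grown from \<open>v0\<close> inside a reserve with \<open>E\<close> as large as possible, is either large
  enough to finish or a complete component.
\<close>

lemma hub_step:
  assumes hs: "hub_state T f" and small: "card T < t"
    and v0: "v0 \<in> S\<^sub>1" "\<not> R `` {v0} \<subseteq> R `` T"
    and no: "\<nexists>h. red_embedding R V B W h"
  shows "\<exists>T' f'. hub_state T' f' \<and> card T < card T'"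
proof -
  have plT: "placed T f" and T: "T \<subseteq> S\<^sub>1"
    and closed: "\<And>v. v \<in> S\<^sub>1 \<Longrightarrow> R `` {v} \<subseteq> R `` T \<or> R `` {v} \<inter> R `` T = {}"
    and count: "card {v \<in> S\<^sub>1. R `` {v} \<subseteq> R `` T} + card (R `` T) \<le> (k + 1) * card T + excess (R `` T)"
    using hs by (auto simp: hub_state_def)
  have finT [simp]: "finite T" using finite_subset[OF T] by simp
  obtain A0 E0 where "reserve T f A0 E0" using hs by (auto simp: hub_state_def)
  then obtain E A where room: "reserve T f A E"
    and max: "\<And>A' E'. reserve T f A' E' \<Longrightarrow> card E' \<le> card E"
  proof (rule ex_max_pair[of "\<lambda>E A. reserve T f A E" E0 A0 card "card U"])
    show "card E' \<le> card U" if "reserve T f A' E'" for E' A'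
      using that by (auto simp: reserve_def intro: card_mono)
  qed blast
  have A: "A \<subseteq> C - f ` (R `` T)" "E \<subseteq> U" "A \<times> E \<subseteq> B"
    using room by (auto simp: reserve_def)
  have "piece T f A {} f" using plT by (simp add: piece_def)
  moreover have "R `` {v0} \<inter> R `` T = {}" using closed[OF v0(1)] v0(2) by blast
  ultimately have "\<exists>h. piece T f A {v0} h"
    using piece_extend[OF T room max, where Q = "{}" and h = f and v = v0] v0(1) nbrs_S1_nonempty[of v0] small by auto
  then obtain h0 where h0: "piece T f A {v0} h0" ..
  obtain Q h where piece: "piece T f A Q h" and Q_ne: "Q \<noteq> {}"
    and Q_max: "\<And>Q' h'. piece T f A Q' h' \<Longrightarrow> Q' \<noteq> {} \<Longrightarrow> card Q' \<le> card Q"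
  proof (rule ex_max_pair[of "\<lambda>Q h. piece T f A Q h \<and> Q \<noteq> {}" "{v0}" h0 card "card S\<^sub>1"])
    show "piece T f A {v0} h0 \<and> {v0} \<noteq> {}" using h0 by simp
    show "card Q \<le> card S\<^sub>1" if "piece T f A Q h \<and> Q \<noteq> {}" for Q h
      using that by (auto simp: piece_def intro: card_mono)
  qed auto
  have Q: "Q \<subseteq> S\<^sub>1" and pl: "placed (T \<union> Q) h" and agree: "\<And>z. z \<in> T \<union> R `` T \<Longrightarrow> h z = f z"
    and dj: "R `` Q \<inter> R `` T = {}" and hA: "h ` (R `` Q) \<subseteq> A"
    and cQ: "card (R `` Q) \<le> k * card Q + 1"
    using piece Q_ne by (auto simp: piece_def)
  have finQ [simp]: "finite Q" using finite_subset[OF Q] by simp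
  have TQ: "card (T \<union> Q) < t"
    using placed_imp_embedding[OF pl] no by (meson not_le)
  have closedQ: "R `` {v} \<subseteq> R `` Q" if v: "v \<in> S\<^sub>1" "R `` {v} \<inter> R `` Q \<noteq> {}" for v
  proof (rule ccontr)
    assume new: "\<not> R `` {v} \<subseteq> R `` Q"
    have "R `` {v} \<inter> R `` T = {}" using closed[OF v(1)] v(2) dj by blast
    then have "\<exists>h'. piece T f A (insert v Q) h'"
      by (intro piece_extend[OF T room _ piece v(1) new _ _ TQ] max) (use v(2) in auto)
    then have "card (insert v Q) \<le> card Q" using Q_max by blast
    moreover have "v \<notin> Q" using new by blast
    ultimately show False by simp
  qed
  have TQ_disj: "T \<inter> Q = {}"
  proof -
    have "R `` {v} = {}" if "v \<in> T \<inter> Q" for v using that dj by blast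
    then show ?thesis using T nbrs_S1_nonempty by blast
  qed
  define P where "P = R `` Q"
  define s where "s = {v \<in> S\<^sub>1. R `` {v} \<subseteq> P}"
  have P_H: "P \<subseteq> H" using nbrs_S1[OF Q] by (simp add: P_def)
  have finP [simp]: "finite P" by (simp add: P_def)
  have fins [simp]: "finite s" by (simp add: s_def)
  have P_V: "P \<subseteq> V" using P_H S_H by blast
  have s_V: "s \<subseteq> V" using S1_subset S_H by (auto simp: s_def)
  have cs: "(k + 1) * card s = card (R \<inter> P \<times> s)"
  proof -
    have "card (R `` {u} \<inter> P) = k + 1" if "u \<in> s" for u
    proof -
      have "R `` {u} \<inter> P = R `` {u}" using that by (auto simp: s_def)
      then show ?thesis using that deg_S[of u] S1_subset by (auto simp: s_def)
    qed
    then have "card (R \<inter> s \<times> P) = (k + 1) * card s"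
      by (simp add: card_relation_Times)
    then show ?thesis using card_relation_converse[OF symR] by metis
  qed
  have cP: "card (R \<inter> P \<times> V) = (k + 1) * card P + excess P"
  proof -
    have "R `` {u} \<inter> V = R `` {u}" for u using RV by blast
    then show ?thesis using sum_deg_eq[OF P_V] by (simp add: card_relation_Times finV)
  qed
  have fin: "finite (R \<inter> P \<times> V)" using fin_R by simp
  have sub: "R \<inter> P \<times> s \<subseteq> R \<inter> P \<times> V" using s_V by blast
  have P_bounds: "card P \<le> k * card Q + 1" "card P \<le> excess P" "1 \<le> card Q"
    using cQ card_le_excess[OF P_H] Q_ne by (auto simp: P_def Suc_le_eq card_gt_0_iff)
  have gain: "card s + card P \<le> (k + 1) * card Q + excess P"
  proof (cases "R \<inter> P \<times> s = R \<inter> P \<times> V")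
    case False
    then have "card (R \<inter> P \<times> s) < card (R \<inter> P \<times> V)"
      using sub by (intro psubset_card_mono[OF fin]) blast
    then show ?thesis using piece_count P_bounds cs cP by simp
  next
    case True
    \<comment> \<open>No edge leaves the piece, so it is the whole guest, which is too large for that.\<close>
    have "R `` P \<subseteq> s" using True RV by blast
    then have "R `` (s \<union> P) \<subseteq> s \<union> P" by (auto simp: s_def)
    moreover have "s \<union> P \<noteq> {}" using P_bounds Q_ne Q nbrs_S1_nonempty by (auto simp: P_def)
    ultimately have "s \<union> P = V" using conn[of "s \<union> P"] s_V P_V by blast
    then have "card V \<le> card s + card P" using card_Un_le by metis
    also have "\<dots> \<le> (k + 1) * card Q + (excess P + 1)"
      using True cs cP P_bounds by (intro piece_count) auto
    also have "excess P \<le> ex"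
      using excess_split[OF P_H] excess_H by simp
    also have "(k + 1) * card Q \<le> (k + 1) * t"
      using TQ TQ_disj by (intro mult_le_mono2) (simp add: card_Un_disjoint)
    finally show ?thesis using gap by simp
  qed
  have NTQ: "R `` (T \<union> Q) = R `` T \<union> P" "R `` T \<inter> P = {}" using dj by (auto simp: P_def)
  have "hub_state (T \<union> Q) h"
    unfolding hub_state_def
  proof (intro conjI ballI)
    show "placed (T \<union> Q) h" "T \<union> Q \<subseteq> S\<^sub>1" using pl T Q by auto
    show "R `` {v} \<subseteq> R `` (T \<union> Q) \<or> R `` {v} \<inter> R `` (T \<union> Q) = {}" if "v \<in> S\<^sub>1" for v
      using closed[OF that] closedQ[OF that] by blast
    have "{v \<in> S\<^sub>1. R `` {v} \<subseteq> R `` (T \<union> Q)} \<subseteq> {v \<in> S\<^sub>1. R `` {v} \<subseteq> R `` T} \<union> s"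
    proof
      fix v assume "v \<in> {v \<in> S\<^sub>1. R `` {v} \<subseteq> R `` (T \<union> Q)}"
      then show "v \<in> {v \<in> S\<^sub>1. R `` {v} \<subseteq> R `` T} \<union> s"
        using closed[of v] unfolding s_def NTQ by blast
    qed
    then have "card {v \<in> S\<^sub>1. R `` {v} \<subseteq> R `` (T \<union> Q)} \<le> card ({v \<in> S\<^sub>1. R `` {v} \<subseteq> R `` T} \<union> s)"
      by (intro card_mono) auto
    also have "\<dots> \<le> card {v \<in> S\<^sub>1. R `` {v} \<subseteq> R `` T} + card s" by (rule card_Un_le)
    finally have c: "card {v \<in> S\<^sub>1. R `` {v} \<subseteq> R `` (T \<union> Q)} \<le> card {v \<in> S\<^sub>1. R `` {v} \<subseteq> R `` T} + card s" .
    have "excess (R `` T \<union> P) = excess (R `` T) + excess P"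
      using NTQ(2) unfolding excess_def by (intro sum.union_disjoint) auto
    moreover have "card (R `` T \<union> P) = card (R `` T) + card P"
      using NTQ(2) by (intro card_Un_disjoint) auto
    moreover have "card (T \<union> Q) = card T + card Q" using TQ_disj by (simp add: card_Un_disjoint)
    ultimately show "card {v \<in> S\<^sub>1. R `` {v} \<subseteq> R `` (T \<union> Q)} + card (R `` (T \<union> Q))
        \<le> (k + 1) * card (T \<union> Q) + excess (R `` (T \<union> Q))"
      using c count gain unfolding NTQ by (simp add: algebra_simps)
    have inj: "inj_on h P"
      by (rule inj_on_subset[of h "(T \<union> Q) \<union> R `` (T \<union> Q)"])
        (use pl in \<open>auto simp: placed_def P_def\<close>)
    have hP: "h ` P \<subseteq> A" using hA by (simp add: P_def)
    have "card (A - h ` P) = card A - card P"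
      using hP inj by (simp add: card_Diff_subset card_image)
    moreover have "card (H - R `` T - P) = card (H - R `` T) - card P"
      using P_H NTQ(2) by (intro card_Diff_subset) auto
    moreover have "card P \<le> card (H - R `` T)"
      using P_H NTQ(2) by (intro card_mono) auto
    moreover have "H - (R `` T \<union> P) = H - R `` T - P" by blast
    ultimately have
      "card (H - (R `` T \<union> P)) \<le> card (A - h ` P) \<and> (card E + (k * t + ex + k + 1) < b \<longrightarrow>
        b + card (H - (R `` T \<union> P)) + k * t \<le> card (A - h ` P) + card E + (k * t + ex + k + 1))"
      using room unfolding reserve_def by auto
    moreover have "h ` (R `` T) = f ` (R `` T)" by (intro image_cong refl agree) blast
    then have "A - h ` P \<subseteq> C - h ` (R `` T \<union> P)" using A(1) unfolding image_Un by blast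
    moreover have "(A - h ` P) \<times> E \<subseteq> B" using A(3) by blast
    ultimately have "reserve (T \<union> Q) h (A - h ` P) E"
      unfolding reserve_def NTQ(1) using A(2) by blast
    then show "\<exists>A E. reserve (T \<union> Q) h A E" by blast
  qed
  moreover have "card T < card (T \<union> Q)"
    using TQ_disj Q_ne by (simp add: card_Un_disjoint card_gt_0_iff)
  ultimately show ?thesis by blast
qed

text \<open>
  When no vertex of \<open>S\<^sub>1\<close> is left over, each hub that \<open>T\<close> does not meet is paid for by its own excess.
\<close>

lemma hub_stage:
  assumes no: "\<nexists>h. red_embedding R V B W h"
  obtains T f where "placed T f" "T \<subseteq> S\<^sub>1" "card S\<^sub>1 + card H \<le> (k + 1) * card T + ex"
proof -
  have "reserve {} f C {}" for f
    using card_H b_ge by (auto simp: reserve_def card_C)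
  moreover have "{v \<in> S\<^sub>1. R `` {v} \<subseteq> {}} = {}" using nbrs_S1_nonempty by blast
  ultimately have "hub_state {} f" for f
    by (auto simp: hub_state_def placed_def excess_def simp del: subset_empty)
  then obtain T f where hs: "hub_state T f"
    and max: "\<And>T' f'. hub_state T' f' \<Longrightarrow> card T' \<le> card T"
  proof (rule ex_max_pair[of hub_state "{}" undefined card t])
    show "card T \<le> t" if "hub_state T f" for T f
      using placed_imp_embedding[of T f] no that unfolding hub_state_def by (meson nat_le_linear)
  qed blast
  have pl: "placed T f" and T: "T \<subseteq> S\<^sub>1" using hs by (auto simp: hub_state_def)
  have "card T < t" using placed_imp_embedding[OF pl] no by (meson not_le)
  then have all: "R `` {v} \<subseteq> R `` T" if "v \<in> S\<^sub>1" for v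
    using hub_step[OF hs _ that _ no] max by (meson not_le)
  then have "{v \<in> S\<^sub>1. R `` {v} \<subseteq> R `` T} = S\<^sub>1" by blast
  then have c1: "card S\<^sub>1 + card (R `` T) \<le> (k + 1) * card T + excess (R `` T)"
    using hs by (auto simp: hub_state_def)
  have c2: "card (H - R `` T) \<le> excess (H - R `` T)" by (rule card_le_excess) blast
  have NH: "R `` T \<subseteq> H" using nbrs_S1[OF T] .
  have "card H = card (R `` T) + card (H - R `` T)"
    using NH by (metis card_Diff_subset card_mono fin_H fin_nbrs le_add_diff_inverse)
  then have "card S\<^sub>1 + card H \<le> (k + 1) * card T + ex"
    using c1 c2 excess_split[OF NH fin_H] excess_H by simp
  then show ?thesis using that pl T by blast
qed

end

subsection \<open>Components of the graph on the vertices of minimum degree\<close>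

context guest
begin

text \<open>
  \<open>J\<close> is connected, presented as grown from \<open>u\<close>. Placing the vertices in the reverse order of
  growth leaves every vertex other than \<open>u\<close> with a neighbour that is not yet placed.
\<close>

inductive spreads :: "'a \<Rightarrow> 'a set \<Rightarrow> bool" for u where
  root: "spreads u {u}"
| grow: "spreads u J \<Longrightarrow> w \<in> J \<Longrightarrow> (w, v) \<in> R \<Longrightarrow> v \<notin> J \<Longrightarrow> spreads u (insert v J)"

lemma spreads_root: "spreads u J \<Longrightarrow> u \<in> J"
  by (induction rule: spreads.induct) auto

lemma spreads_new_root:
  "spreads w J \<Longrightarrow> (v, w) \<in> R \<Longrightarrow> v \<notin> J \<Longrightarrow> spreads v (insert v J)"
proof (induction rule: spreads.induct)
  case root
  then show ?case using spreads.grow[OF spreads.root, of v v w] by (simp add: insert_commute)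
next
  case (grow J w' v')
  have "spreads v (insert v' (insert v J))"
  proof (rule spreads.grow)
    show "spreads v (insert v J)" using grow by blast
    show "w' \<in> insert v J" using grow by blast
    show "(w', v') \<in> R" by fact
    show "v' \<notin> insert v J" using grow by blast
  qed
  then show ?case by (simp add: insert_commute)
qed

definition connected_in :: "'a set \<Rightarrow> bool" where
  "connected_in J \<longleftrightarrow> (\<forall>u\<in>J. spreads u J)"

lemma connected_in_singleton: "connected_in {u}"
  by (simp add: connected_in_def spreads.root)

lemma connected_in_insert:
  assumes "connected_in J" "w \<in> J" "(w, v) \<in> R" "v \<notin> J"
  shows "connected_in (insert v J)"
  unfolding connected_in_def
proof
  fix u assume "u \<in> insert v J"
  then show "spreads u (insert v J)"
  proof
    assume "u = v"
    then show ?thesis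
      using spreads_new_root[of w J v] assms adj_sym[of v w] by (simp add: connected_in_def)
  next
    assume "u \<in> J"
    then show ?thesis using spreads.grow[of u J w v] assms by (simp add: connected_in_def)
  qed
qed

end

context tight_case
begin

text \<open>
  \<open>g'\<close> prolongs the placement \<open>g\<close> of \<open>Y\<close> by positions outside \<open>C\<close> for the vertices of \<open>Z\<close>.
\<close>

definition extends :: "'a set \<Rightarrow> 'a set \<Rightarrow> ('a \<Rightarrow> 'b) \<Rightarrow> ('a \<Rightarrow> 'b) \<Rightarrow> bool" where
  "extends Y Z g g' \<longleftrightarrow> (\<forall>z\<in>Y. g' z = g z) \<and> inj_on g' (Y \<union> Z) \<and> g' ` Z \<subseteq> U \<and>
     (\<forall>v\<in>Z. \<forall>z\<in>Y \<union> Z. (v, z) \<in> R \<longrightarrow> (g' v, g' z) \<notin> B)"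

lemma extendsD:
  assumes "extends Y Z g g'"
  shows "z \<in> Y \<Longrightarrow> g' z = g z" "inj_on g' (Y \<union> Z)" "g' ` Z \<subseteq> U"
    "v \<in> Z \<Longrightarrow> z \<in> Y \<union> Z \<Longrightarrow> (v, z) \<in> R \<Longrightarrow> (g' v, g' z) \<notin> B"
  using assms by (simp_all add: extends_def)

lemma place_all_but_root:
  assumes "spreads u J" "J \<subseteq> S" "Y \<inter> J = {}" "inj_on g Y" "g ` Y \<subseteq> C \<union> U"
    and "card (g ` Y \<inter> U) + card J \<le> t"
  shows "\<exists>g'. extends Y (J - {u}) g g'"
  using assms
proof (induction arbitrary: Y g rule: spreads.induct)
  case root
  then show ?case by (intro exI[of _ g]) (simp add: extends_def)
next
  case (grow J w v)
  have finJ: "finite J" using grow.prems(1) finite_subset[OF _ fin_S] by blast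
  have uJ: "u \<in> J" using spreads_root grow.hyps(1) .
  have vu: "v \<noteq> u" using uJ grow.hyps by blast
  have vS: "v \<in> S" and v_Y: "v \<notin> Y" using grow.prems by auto
  define X where "X = g ` Y \<inter> U"
  have finX [simp]: "finite X" by (simp add: X_def)
  have cX: "card X + card J + 1 \<le> t" using grow.prems(5) grow.hyps(4) finJ by (simp add: X_def)
  define Z where "Z = g ` (R `` {v} \<inter> Y)"
  have cZ: "card Z \<le> k"
  proof -
    have "w \<in> R `` {v}" using grow.hyps adj_sym[of v w] by simp
    then have "card (R `` {v} - {w}) = k" using deg_S[OF vS] by simp
    moreover have "R `` {v} \<inter> Y \<subseteq> R `` {v} - {w}" using grow.hyps grow.prems(2) by blast
    ultimately have "card (R `` {v} \<inter> Y) \<le> k" by (metis card_mono fin_nbrs finite_Diff)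
    then show ?thesis unfolding Z_def using card_image_le[of "R `` {v} \<inter> Y" g] by simp
  qed
  have Z: "Z \<subseteq> C \<union> U" using grow.prems(4) by (auto simp: Z_def)
  have "finite Z" by (simp add: Z_def)
  then have "card (Z \<inter> U) \<le> card Z" by (intro card_mono) auto
  moreover have "card X < t" using cX by simp
  ultimately have "0 < card (choices Z X)" using card_choices[OF Z cZ finX] cZ by linarith
  then obtain y where y: "y \<in> choices Z X" by (metis card_gt_0_iff ex_in_conv)
  have yU: "y \<in> U" and y_X: "y \<notin> X" and y_red: "\<And>z. z \<in> R `` {v} \<inter> Y \<Longrightarrow> (y, g z) \<notin> B"
    using y by (auto simp: choices_def Z_def)
  have y_Y: "y \<notin> g ` Y" using y_X yU by (simp add: X_def)
  define g1 where "g1 = g(v := y)"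
  have g1Y: "g1 z = g z" if "z \<in> Y" for z using that v_Y by (auto simp: g1_def)
  have g1v: "g1 v = y" by (simp add: g1_def)
  have im: "g1 ` insert v Y = insert y (g ` Y)"
  proof -
    have "g1 ` Y = g ` Y" by (intro image_cong refl g1Y)
    then show ?thesis by (simp add: g1v)
  qed
  have "\<exists>g'. extends (insert v Y) (J - {u}) g1 g'"
  proof (rule grow.IH)
    show "J \<subseteq> S" "insert v Y \<inter> J = {}" using grow.prems grow.hyps by auto
    show "inj_on g1 (insert v Y)"
      unfolding g1_def using grow.prems(3) v_Y y_Y by (rule inj_on_fun_upd_insert)
    show "g1 ` insert v Y \<subseteq> C \<union> U" unfolding im using grow.prems(4) yU by blast
    have "g1 ` insert v Y \<inter> U = insert y X" unfolding im X_def using yU by blast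
    then show "card (g1 ` insert v Y \<inter> U) + card J \<le> t" using y_X cX by simp
  qed
  then obtain g' where ext: "extends (insert v Y) (J - {u}) g1 g'" ..
  note g' = extendsD(1)[OF ext] and inj = extendsD(2)[OF ext] and gU = extendsD(3)[OF ext]
    and edge = extendsD(4)[OF ext]
  have g'v: "g' v = y" using g'[of v] g1v by simp
  have dom: "Y \<union> (insert v J - {u}) = insert v Y \<union> (J - {u})" using vu by blast
  have "extends Y (insert v J - {u}) g g'"
    unfolding extends_def
  proof (intro conjI ballI impI)
    show "g' z = g z" if "z \<in> Y" for z using g'[of z] g1Y[OF that] that by simp
    show "inj_on g' (Y \<union> (insert v J - {u}))" unfolding dom by (rule inj)
    show "g' ` (insert v J - {u}) \<subseteq> U" using gU g'v yU by auto
    fix v' z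
    assume v': "v' \<in> insert v J - {u}" and z: "z \<in> Y \<union> (insert v J - {u})" and vz: "(v', z) \<in> R"
    show "(g' v', g' z) \<notin> B"
    proof (cases "v' = v")
      case False
      then show ?thesis using edge[of v' z] v' z[unfolded dom] vz by simp
    next
      case True
      have "z \<noteq> v" using vz True by auto
      then consider "z \<in> Y" | "z \<in> J - {u}" using z by blast
      then show ?thesis
      proof cases
        case 1
        then have "z \<in> R `` {v} \<inter> Y" using vz True by blast
        then have "(y, g z) \<notin> B" by (rule y_red)
        moreover have "g' z = g z" using g'[of z] g1Y 1 by simp
        ultimately show ?thesis using True g'v by simp
      next
        case 2
        then have "(g' z, g' v) \<notin> B" using edge[of z v] vz True adj_sym[of z v] by simp
        then show ?thesis using True blue_sym[of "g' z" "g' v"] by simp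
      qed
    qed
  qed
  then show ?case by blast
qed

text \<open>
  \<open>D\<close> is the set of used-up vertices of minimum degree, a union of components of the graph induced
  on \<open>S\<close>. The bound on \<open>R `` T \<inter> S - T\<close> limits the part of \<open>C\<close> that is occupied by vertices that are
  not hubs.
\<close>

definition tree_state :: "'a set \<Rightarrow> ('a \<Rightarrow> 'b) \<Rightarrow> 'a set \<Rightarrow> bool" where
  "tree_state T f D \<longleftrightarrow> placed T f \<and> T \<subseteq> D \<and> D \<subseteq> S \<and> S\<^sub>1 \<subseteq> D \<and> R `` D \<inter> S \<subseteq> D \<and>
     card (R `` T \<inter> S - T) \<le> k * card T \<and> card D + card H \<le> (k + 1) * card T + ex"

text \<open>
  A connected part \<open>J\<close> of the component \<open>K\<close> that is to be placed outside \<open>C\<close> when \<open>s\<close> vertices are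
  there already. The vertex \<open>\<rho>\<close> is the neighbour of \<open>u\<close> that is kept for last; as it has no other
  neighbour in \<open>J\<close>, it only has to be made red to \<open>u\<close> if it goes into \<open>C\<close>.
\<close>

definition probe :: "'a set \<Rightarrow> nat \<Rightarrow> 'a set \<Rightarrow> bool" where
  "probe K s J \<longleftrightarrow> connected_in J \<and> J \<noteq> {} \<and> J \<subseteq> K \<and> s + card J \<le> t \<and>
     card (J \<union> (R `` J \<inter> S)) \<le> k * card J + 2 \<and>
     (\<exists>u\<in>J. \<exists>\<rho>\<in>K - J. R `` {\<rho>} \<inter> J = {u})"

text \<open>
  Take \<open>J\<close> as large as possible. If \<open>J\<close> does not dominate \<open>K\<close>, then some neighbour \<open>v\<close> of \<open>J\<close> has a
  neighbour \<open>z\<close> outside the closed neighbourhood of \<open>J\<close>, and \<open>v\<close> can be added with \<open>z\<close> as the new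
  \<open>\<rho>\<close>. So \<open>J\<close> dominates \<open>K\<close>, which gives \<open>card K \<le> k * card J + 2\<close>, and this suffices if \<open>J\<close> has two
  elements. If \<open>J\<close> is a single vertex and \<open>card K = k + 2\<close>, then either two non-adjacent vertices of
  \<open>K\<close> allow a larger \<open>J\<close>, or \<open>K\<close> is a clique without outgoing edges and hence the whole guest.
\<close>

lemma large_probe:
  assumes K: "K \<noteq> {}" "K \<subseteq> S" "R `` K \<inter> S \<subseteq> K"
    and cut: "\<And>J. J \<subseteq> K \<Longrightarrow> J \<noteq> {} \<Longrightarrow> J \<noteq> K \<Longrightarrow> \<exists>u\<in>J. \<exists>v\<in>K - J. (u, v) \<in> R"
    and no_S1: "K \<inter> S\<^sub>1 = {}" and s: "s < t"
  obtains J where "probe K s J" "s + card J = t \<or> card K \<le> (k + 1) * card J"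
proof -
  have finK [simp]: "finite K" using K(2) finite_subset fin_S by blast
  obtain u0 where u0: "u0 \<in> K" using K(1) by blast
  have "u0 \<in> S" "u0 \<notin> S\<^sub>1" using u0 K(2) no_S1 by auto
  then obtain v0 where v0: "(u0, v0) \<in> R" "v0 \<notin> H" unfolding S\<^sub>1_def by blast
  have "v0 \<in> V" using v0(1) RV by blast
  then have "v0 \<in> S" using v0(2) S_H(1) by (metis UnE)
  then have "v0 \<in> K" using u0 v0(1) K(3) by blast
  moreover have "v0 \<noteq> u0" using v0(1) by auto
  ultimately have v0K: "v0 \<in> K - {u0}" by blast
  have "probe K s {u0}"
    unfolding probe_def
  proof (intro conjI)
    show "connected_in {u0}" by (rule connected_in_singleton)
    have "card (R `` {u0} \<inter> S) \<le> k + 1"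
      using deg_S[OF \<open>u0 \<in> S\<close>] card_mono[of "R `` {u0}" "R `` {u0} \<inter> S"] by simp
    then show "card ({u0} \<union> (R `` {u0} \<inter> S)) \<le> k * card {u0} + 2"
      using card_Un_le[of "{u0}" "R `` {u0} \<inter> S"] by simp
    have "R `` {v0} \<inter> {u0} = {u0}" using v0 adj_sym[of u0 v0] by blast
    then show "\<exists>u\<in>{u0}. \<exists>\<rho>\<in>K - {u0}. R `` {\<rho>} \<inter> {u0} = {u}" using v0K by blast
  qed (use u0 s in auto)
  then obtain J c where J: "probe K s J" and max: "\<And>J' c'. probe K s J' \<Longrightarrow> card J' \<le> card J"
  proof (rule ex_max_pair[of "\<lambda>J c. probe K s J" "{u0}" "()" card t])
    show "card J \<le> t" if "probe K s J" for J using that by (simp add: probe_def)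
  qed blast
  have con: "connected_in J" and J_ne: "J \<noteq> {}" and J_K: "J \<subseteq> K" and sJ: "s + card J \<le> t"
    and cN: "card (J \<union> (R `` J \<inter> S)) \<le> k * card J + 2"
    using J unfolding probe_def by blast+
  have finJ [simp]: "finite J" using finite_subset[OF J_K] by simp
  define J2 where "J2 = J \<union> (R `` J \<inter> S)"
  have J2: "J2 \<subseteq> K" "J2 \<noteq> {}" "card J2 \<le> k * card J + 2" using J_K K(3) J_ne cN by (auto simp: J2_def)
  have extend: False
    if lt: "s + card J < t" and w: "w \<in> J" "(w, v) \<in> R" "v \<notin> J" "v \<in> K"
      and c: "card (insert v J \<union> (R `` insert v J \<inter> S)) \<le> k * (card J + 1) + 2"
      and z: "u \<in> insert v J" "z \<in> K - insert v J" "R `` {z} \<inter> insert v J = {u}" for w v u z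
  proof -
    have "probe K s (insert v J)"
      unfolding probe_def
    proof (intro conjI)
      show "connected_in (insert v J)" using con w(1-3) by (rule connected_in_insert)
      show "\<exists>u\<in>insert v J. \<exists>\<rho>\<in>K - insert v J. R `` {\<rho>} \<inter> insert v J = {u}" using z by blast
      show "card (insert v J \<union> R `` insert v J \<inter> S) \<le> k * card (insert v J) + 2" using c w(3) by simp
    qed (use lt w J_K in auto)
    then show False using max w(3) by force
  qed
  have "card K \<le> (k + 1) * card J" if lt: "s + card J < t"
  proof -
    have "J2 = K"
    proof (rule ccontr)
      assume "J2 \<noteq> K"
      then obtain v z where v: "v \<in> J2" and z: "z \<in> K - J2" and vz: "(v, z) \<in> R"
        using cut[OF J2(1,2)] by blast
      have v_J: "v \<notin> J" using z vz K(2) by (auto simp: J2_def)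
      then obtain w where w: "w \<in> J" "(w, v) \<in> R" using v by (auto simp: J2_def)
      have "w \<in> R `` {v}" using w adj_sym[of w v] by simp
      moreover have "v \<in> S" using v J2(1) K(2) by blast
      ultimately have cv: "card (R `` {v} - {w}) = k" using deg_S[of v] by simp
      have "insert v J \<union> (R `` insert v J \<inter> S) \<subseteq> J2 \<union> (R `` {v} - {w})"
        using v w by (auto simp: J2_def)
      then have "card (insert v J \<union> (R `` insert v J \<inter> S)) \<le> card (J2 \<union> (R `` {v} - {w}))"
        using J2(1) by (intro card_mono) (auto intro: finite_subset)
      then have "card (insert v J \<union> (R `` insert v J \<inter> S)) \<le> k * (card J + 1) + 2"
        using card_Un_le[of J2 "R `` {v} - {w}"] J2(3) cv by simp
      moreover have "R `` {z} \<inter> insert v J = {v}"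
      proof -
        have "(q, z) \<notin> R" if "q \<in> J" for q using that z K(2) by (auto simp: J2_def)
        then show ?thesis using vz adj_sym by blast
      qed
      moreover have "z \<noteq> v" "z \<notin> J" using vz z by (auto simp: J2_def)
      ultimately show False using extend[OF lt w v_J, of v z] v z J2(1) by blast
    qed
    then have cK: "card K \<le> k * card J + 2" using J2(3) by simp
    have "0 < card J" using J_ne by (simp add: card_gt_0_iff)
    then consider "2 \<le> card J" | "card J = 1" by linarith
    then show ?thesis
    proof cases
      case 1
      then show ?thesis using cK by simp
    next
      case 2
      then obtain u where u: "J = {u}" by (metis card_1_singletonE)
      have uK: "u \<in> K" using J_K u by blast
      have star: "(u, v) \<in> R" if "v \<in> K - {u}" for v
        using that \<open>J2 = K\<close> unfolding J2_def u by blast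
      show ?thesis
      proof (rule ccontr)
        assume "\<not> ?thesis"
        then have cK: "card K = k + 2" using cK 2 by simp
        have full: "R `` {v} = K - {v}" if v: "v \<in> K" for v
        proof -
          have "K - {v} \<subseteq> R `` {v}"
          proof
            fix z assume z: "z \<in> K - {v}"
            show "z \<in> R `` {v}"
            proof (rule ccontr)
              assume nz: "z \<notin> R `` {v}"
              have vu: "v \<noteq> u" "z \<noteq> u" using nz star[of z] star[of v] z v adj_sym[of u v] by auto
              have uv: "(u, v) \<in> R" "(u, z) \<in> R" using star vu v z by auto
              have "insert v J \<union> (R `` insert v J \<inter> S) \<subseteq> K" using v uK u K(2,3) by blast
              then have "card (insert v J \<union> (R `` insert v J \<inter> S)) \<le> card K" by (intro card_mono) auto
              then have "card (insert v J \<union> (R `` insert v J \<inter> S)) \<le> k * (card J + 1) + 2"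
                using cK 2 by simp
              moreover have "R `` {z} \<inter> insert v J = {u}"
                using nz uv u adj_sym[of v z] adj_sym[of u z] by auto
              ultimately show False using extend[OF lt, of u v u z] u uv vu v z by auto
            qed
          qed
          moreover have "card (K - {v}) = card (R `` {v})" using v cK deg_S[of v] K(2) by auto
          ultimately show ?thesis by (metis card_subset_eq fin_nbrs)
        qed
        then have "R `` K \<subseteq> K" by blast
        moreover have "K \<subseteq> V" using K(2) S_H(1) by blast
        ultimately have "K = V" using conn[of K] K(1) by simp
        moreover have "(k + 1) * 1 \<le> (k + 1) * t" using t_pos by (rule mult_le_mono2)
        ultimately show False using gap cK by simp
      qed
    qed
  qed
  then have "s + card J = t \<or> card K \<le> (k + 1) * card J" using sJ by linarith
  with J show ?thesis by (rule that)
qed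

text \<open>
  Choose a component \<open>K\<close> that is not used up, and in it \<open>J\<close>, \<open>u\<close> and \<open>\<rho>\<close> as in \<open>probe\<close>. Place the
  outer neighbours \<open>bd\<close> of \<open>J' = J \<union> {\<rho>}\<close> in \<open>C\<close> and \<open>J - {u}\<close> greedily outside \<open>C\<close>. There remain lists
  \<open>Y\<^sub>u\<close> of positions for \<open>u\<close> and \<open>Q\<close> of positions for \<open>\<rho>\<close>, the latter made up of the free part \<open>F\<close> of
  \<open>C\<close> and of the list \<open>Y\<^sub>\<rho>\<close> of positions outside \<open>C\<close>. If no position of \<open>u\<close> is red to a different
  position of \<open>\<rho>\<close>, then each element of \<open>Y\<^sub>u\<close> is blue to all other elements of \<open>Q\<close>. Counting
  gives \<open>card Q > b\<close>, which forces \<open>Y\<^sub>u \<subseteq> Q\<close>, and two elements of \<open>Y\<^sub>u\<close> form a blue triangle with a third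
  element of \<open>Q\<close>.
\<close>

lemma tree_step:
  assumes st: "tree_state T f D" and small: "card T < t"
    and no: "\<nexists>h. red_embedding R V B W h"
  shows "\<exists>T' f' D'. tree_state T' f' D' \<and> card T < card T'"
proof -
  have pl: "placed T f" and TD: "T \<subseteq> D" and DS: "D \<subseteq> S" and S1D: "S\<^sub>1 \<subseteq> D"
    and D_closed: "R `` D \<inter> S \<subseteq> D" and cNT: "card (R `` T \<inter> S - T) \<le> k * card T"
    and cD: "card D + card H \<le> (k + 1) * card T + ex"
    using st by (simp_all add: tree_state_def)
  have finD [simp]: "finite D" using finite_subset[OF DS] by simp
  have finT [simp]: "finite T" using finite_subset[OF TD] by simp
  have S_V: "S \<subseteq> V" using S_H by blast
  have "D \<noteq> S"
  proof
    assume "D = S"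
    then have "card V \<le> (k + 1) * card T + ex" using cD card_S_H by simp
    also have "(k + 1) * card T \<le> (k + 1) * t" using small by (intro mult_le_mono2) simp
    finally show False using gap by simp
  qed
  \<comment> \<open>A smallest nonempty closed set is connected, so paths are not needed.\<close>
  define closed where "closed X \<longleftrightarrow> X \<noteq> {} \<and> X \<subseteq> S - D \<and> R `` X \<inter> S \<subseteq> X" for X
  have "closed (S - D)"
  proof -
    have "q \<notin> D" if "p \<in> S - D" "(p, q) \<in> R" for p q
      using that D_closed adj_sym[of p q] by blast
    then show ?thesis using \<open>D \<noteq> S\<close> DS unfolding closed_def by blast
  qed
  then obtain K where K: "closed K" and K_min: "\<And>X. closed X \<Longrightarrow> card K \<le> card X"
    using ex_has_least_nat[of closed "S - D" card] by blast
  have K_ne: "K \<noteq> {}" and K_SD: "K \<subseteq> S - D" and K_closed: "R `` K \<inter> S \<subseteq> K"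
    using K by (simp_all add: closed_def)
  have KS: "K \<subseteq> S" and KD: "K \<inter> D = {}" using K_SD by auto
  have finK [simp]: "finite K" using finite_subset[OF KS] by simp
  have cut: "\<exists>u\<in>J. \<exists>v\<in>K - J. (u, v) \<in> R" if J: "J \<subseteq> K" "J \<noteq> {}" "J \<noteq> K" for J
  proof (rule ccontr)
    assume none: "\<not> ?thesis"
    have "R `` J \<inter> S \<subseteq> J" using none J(1) K_closed by blast
    then have "closed J" using J K_SD by (auto simp: closed_def)
    then have "card K \<le> card J" by (rule K_min)
    then show False using card_seteq[OF finK J(1)] J(3) by blast
  qed
  have KS1: "K \<inter> S\<^sub>1 = {}" using KD S1D by blast
  obtain J where J: "probe K (card T) J" and big: "card T + card J = t \<or> card K \<le> (k + 1) * card J"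
    using large_probe[OF K_ne KS K_closed cut KS1 small] by blast
  have con: "connected_in J" and J_ne: "J \<noteq> {}" and JK: "J \<subseteq> K" and TJ: "card T + card J \<le> t"
    and cN: "card (J \<union> (R `` J \<inter> S)) \<le> k * card J + 2"
    using J by (simp_all add: probe_def)
  obtain u \<rho> where u: "u \<in> J" and \<rho>: "\<rho> \<in> K" "\<rho> \<notin> J" and \<rho>u: "R `` {\<rho>} \<inter> J = {u}"
    using J by (auto simp: probe_def)
  have u\<rho>: "(u, \<rho>) \<in> R" "(\<rho>, u) \<in> R" using \<rho>u adj_sym[of u \<rho>] by blast+
  have finJ [simp]: "finite J" using finite_subset[OF JK] by simp
  have JS: "J \<subseteq> S" and uS: "u \<in> S" and \<rho>S: "\<rho> \<in> S" using JK KS u \<rho> by auto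
  have cJ: "1 \<le> card J" using J_ne by (simp add: Suc_le_eq card_gt_0_iff)
  define J' where "J' = insert \<rho> J"
  have J'K: "J' \<subseteq> K" using JK \<rho> by (simp add: J'_def)
  have finJ' [simp]: "finite J'" by (simp add: J'_def)
  have cJ': "card J' = card J + 1" using \<rho> by (simp add: J'_def)
  \<comment> \<open>Whether \<open>\<rho>\<close> ends up inside or outside \<open>C\<close> decides between \<open>L = J\<close> and \<open>L = J'\<close>.\<close>
  have advance: "\<exists>T' f' D'. tree_state T' f' D' \<and> card T < card T'"
    if L: "J \<subseteq> L" "L \<subseteq> K" and plL: "placed (T \<union> L) h" for L h
  proof -
    have finL [simp]: "finite L" using finite_subset[OF L(2)] by simp
    have "T \<inter> L = {}" using TD L(2) KD by blast
    then have cTL: "card (T \<union> L) = card T + card L" by (simp add: card_Un_disjoint)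
    have "card (T \<union> L) < t" using placed_imp_embedding[OF plL] no by (meson not_le)
    moreover have JL: "card J \<le> card L" using L(1) by (intro card_mono) auto
    ultimately have "card K \<le> (k + 1) * card J" using big cTL by simp
    also have "\<dots> \<le> (k + 1) * card L" using JL by (rule mult_le_mono2)
    finally have cK: "card K \<le> (k + 1) * card L" .
    have "tree_state (T \<union> L) h (D \<union> K)"
      unfolding tree_state_def
    proof (intro conjI)
      show "placed (T \<union> L) h" by (rule plL)
      show "T \<union> L \<subseteq> D \<union> K" "D \<union> K \<subseteq> S" "S\<^sub>1 \<subseteq> D \<union> K" using TD L DS KS S1D by auto
      show "R `` (D \<union> K) \<inter> S \<subseteq> D \<union> K" using D_closed K_closed by blast
      have "R `` (T \<union> L) \<inter> S - (T \<union> L) \<subseteq> (R `` T \<inter> S - T) \<union> (K - L)"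
        using L(2) K_closed by blast
      then have "card (R `` (T \<union> L) \<inter> S - (T \<union> L)) \<le> card ((R `` T \<inter> S - T) \<union> (K - L))"
        by (intro card_mono) auto
      also have "\<dots> \<le> card (R `` T \<inter> S - T) + card (K - L)" by (rule card_Un_le)
      also have "card (K - L) = card K - card L" using L(2) by (simp add: card_Diff_subset)
      finally show "card (R `` (T \<union> L) \<inter> S - (T \<union> L)) \<le> k * card (T \<union> L)"
        using cNT cK by (simp add: cTL algebra_simps)
      have "card (D \<union> K) \<le> card D + card K" by (rule card_Un_le)
      then show "card (D \<union> K) + card H \<le> (k + 1) * card (T \<union> L) + ex"
        using cD cK by (simp add: cTL algebra_simps)
    qed
    moreover have "card T < card (T \<union> L)" using cTL JL cJ by simp
    ultimately show ?thesis by blast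
  qed
  have TV: "T \<subseteq> V" and injf: "inj_on f (T \<union> R `` T)" and fT: "f ` T \<subseteq> U" and fN: "f ` (R `` T - T) \<subseteq> C"
    and f_edge: "\<And>v z. v \<in> T \<Longrightarrow> (v, z) \<in> R \<Longrightarrow> (f v, f z) \<notin> B"
    using pl by (auto simp: placed_def)
  define X where "X = T \<union> R `` T"
  define bd where "bd = R `` J' - J'"
  define M where "M = (R `` T - T) \<union> bd"
  define Y where "Y = X \<union> bd"
  have finX [simp]: "finite X" and finbd [simp]: "finite bd" and finM [simp]: "finite M"
    by (simp_all add: X_def bd_def M_def)
  have KT: "K \<inter> X = {}"
  proof -
    have "R `` T \<inter> S \<subseteq> D" using TD D_closed by blast
    then have "K \<inter> R `` T = {}" using KS KD by blast
    then show ?thesis using TD KD by (auto simp: X_def)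
  qed
  have T_bd: "T \<inter> bd = {}"
  proof -
    have "z \<notin> T" if "z \<in> R `` J'" for z
      using that adj_sym J'K KT unfolding X_def by blast
    then show ?thesis by (auto simp: bd_def)
  qed
  have YJ': "Y \<inter> J' = {}" using KT J'K by (auto simp: Y_def bd_def)
  have cM: "card M = card (R `` T - T) + card (bd - X)"
  proof -
    have "M = (R `` T - T) \<union> (bd - X)" using T_bd by (auto simp: M_def X_def)
    moreover have "(R `` T - T) \<inter> (bd - X) = {}" by (auto simp: X_def)
    ultimately show ?thesis by (metis card_Un_disjoint fin_nbrs finbd finite_Diff)
  qed
  have c_bd: "card (bd \<inter> S) + card J + 1 \<le> k * card J + k + 2"
  proof -
    let ?A = "J \<union> (R `` J \<inter> S)"
    have "J' \<union> (bd \<inter> S) \<subseteq> ?A \<union> (R `` {\<rho>} - {u})"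
      using u\<rho> \<rho>S u by (auto simp: J'_def bd_def)
    then have "card (J' \<union> (bd \<inter> S)) \<le> card (?A \<union> (R `` {\<rho>} - {u}))"
      by (intro card_mono) auto
    also have "\<dots> \<le> card ?A + card (R `` {\<rho>} - {u})" by (rule card_Un_le)
    also have "card (R `` {\<rho>} - {u}) = k" using u\<rho> deg_S[OF \<rho>S] by simp
    finally have "card (J' \<union> (bd \<inter> S)) \<le> k * card J + 2 + k" using cN by simp
    moreover have "card (J' \<union> (bd \<inter> S)) = card J' + card (bd \<inter> S)"
      by (intro card_Un_disjoint) (auto simp: bd_def)
    ultimately show ?thesis using cJ' by simp
  qed
  have M_le: "card M \<le> ex + k * card T + card (bd \<inter> S)"
  proof -
    have "M \<subseteq> V" using nbrs_subset by (auto simp: M_def bd_def)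
    then have "M \<subseteq> H \<union> ((R `` T \<inter> S - T) \<union> (bd \<inter> S))" using S_H(1) by (auto simp: M_def)
    then have "card M \<le> card (H \<union> ((R `` T \<inter> S - T) \<union> (bd \<inter> S)))" by (intro card_mono) auto
    also have "\<dots> \<le> card H + (card (R `` T \<inter> S - T) + card (bd \<inter> S))"
      by (meson add_left_mono card_Un_le le_trans)
    finally show ?thesis using card_H cNT by simp
  qed
  have kt: "k * card T + k * card J \<le> k * t" using mult_le_mono2[OF TJ, of k] by (simp add: distrib_left)
  \<comment> \<open>If \<open>t\<close> vertices will be outside \<open>C\<close>, too few remain to overfill \<open>C\<close>; otherwise the bound on
    \<open>R `` T \<inter> S - T\<close> has enough slack.\<close>
  have M_b: "card M \<le> b"
  proof (cases "card T + card J = t")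
    case True
    have "M \<inter> (T \<union> J') = {}" using T_bd YJ' by (auto simp: M_def Y_def X_def)
    moreover have "T \<inter> J' = {}" using J'K KT by (auto simp: X_def)
    ultimately have "card (M \<union> (T \<union> J')) = card M + (card T + card J')"
      by (simp add: card_Un_disjoint)
    moreover have "M \<union> (T \<union> J') \<subseteq> V" using nbrs_subset TV J'K KS S_V by (auto simp: M_def bd_def)
    then have "card (M \<union> (T \<union> J')) \<le> card V" using finV by (rule card_mono[rotated])
    ultimately show ?thesis using True b_t cJ' by simp
  next
    case False
    then have "k * (card T + card J + 1) \<le> k * t" using TJ by (intro mult_le_mono2) simp
    then show ?thesis using M_le c_bd cJ b_ge by (simp add: distrib_left)
  qed
  have cfN: "card (f ` (R `` T - T)) = card (R `` T - T)"
    by (rule card_image) (rule inj_on_subset[OF injf], auto)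
  have "card (C - f ` (R `` T - T)) = b - card (R `` T - T)"
    using fN cfN by (simp add: card_Diff_subset card_C)
  then have le: "card (bd - X) \<le> card (C - f ` (R `` T - T))" using M_b cM by simp
  have disj: "(C - f ` (R `` T - T)) \<inter> f ` X = {}" using fT C_U(3) unfolding X_def by blast
  have "inj_on f X" using injf by (simp add: X_def)
  then obtain g where gX: "\<And>z. z \<in> X \<Longrightarrow> g z = f z" and injg: "inj_on g Y"
    and gbd: "g ` (bd - X) \<subseteq> C - f ` (R `` T - T)"
    using extend_inj_on[OF _ finbd _ disj le] unfolding Y_def by (metis fin_C finite_Diff)
  have gT: "g ` T = f ` T" by (intro image_cong refl gX) (simp add: X_def)
  have gM: "g ` M \<subseteq> C"
  proof -
    have "g z \<in> C" if "z \<in> M" for z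
    proof (cases "z \<in> X")
      case True
      then have "z \<in> R `` T - T" using that T_bd by (auto simp: M_def X_def)
      then show ?thesis using gX[OF True] fN by auto
    next
      case False
      then have "z \<in> bd - X" using that by (auto simp: M_def X_def)
      then show ?thesis using gbd by blast
    qed
    then show ?thesis by blast
  qed
  have Y_TM: "Y = T \<union> M" by (auto simp: Y_def M_def X_def)
  have gYU: "g ` Y \<inter> U = f ` T" using gM fT C_U(3) unfolding Y_TM image_Un gT by blast
  have cfT: "card (f ` T) = card T" by (rule card_image) (rule inj_on_subset[OF injf], auto)
  have spread: "spreads u J" using con u by (simp add: connected_in_def)
  have "\<exists>g'. extends Y (J - {u}) g g'"
  proof (rule place_all_but_root[OF spread JS _ injg])
    show "Y \<inter> J = {}" using YJ' by (auto simp: J'_def)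
    show "g ` Y \<subseteq> C \<union> U" using gM fT unfolding Y_TM image_Un gT by blast
    show "card (g ` Y \<inter> U) + card J \<le> t" using gYU cfT TJ by simp
  qed
  then obtain p where ext: "extends Y (J - {u}) g p" ..
  note pY = extendsD(1)[OF ext] and injp = extendsD(2)[OF ext] and pJ = extendsD(3)[OF ext]
    and p_edge = extendsD(4)[OF ext]
  have pM: "p ` M \<subseteq> C"
  proof -
    have "p ` M = g ` M" by (intro image_cong refl pY) (simp add: Y_TM)
    then show ?thesis using gM by simp
  qed
  have pT: "p ` T \<subseteq> U"
  proof -
    have "p ` T = g ` T" by (intro image_cong refl pY) (simp add: Y_TM)
    then show ?thesis using gT fT by simp
  qed
  have p_edge_T: "(p v, p z) \<notin> B" if "v \<in> T" "(v, z) \<in> R" for v z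
  proof -
    have "v \<in> X" "z \<in> X" using that by (auto simp: X_def)
    then show ?thesis using f_edge[OF that] pY gX by (simp add: Y_def)
  qed
  define used where "used = p ` (T \<union> (J - {u}))"
  have used: "finite used" "card used < t" "used \<subseteq> U"
  proof -
    have "card used \<le> card (T \<union> (J - {u}))" unfolding used_def by (intro card_image_le) simp
    also have "\<dots> \<le> card T + card (J - {u})" by (rule card_Un_le)
    also have "card (J - {u}) < card J" using u by (intro psubset_card_mono) auto
    finally show "card used < t" using TJ by simp
    show "finite used" "used \<subseteq> U" using pT pJ by (auto simp: used_def)
  qed
  define N\<^sub>u where "N\<^sub>u = R `` {u} - {\<rho>}"
  define N\<^sub>\<rho> where "N\<^sub>\<rho> = R `` {\<rho>} - {u}"
  have \<rho>_only: "z = u" if "(\<rho>, z) \<in> R" "z \<in> J" for z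
  proof -
    have "z \<in> R `` {\<rho>} \<inter> J" using that by simp
    then show ?thesis by (simp only: \<rho>u singleton_iff)
  qed
  have N\<^sub>\<rho>_bd: "N\<^sub>\<rho> \<subseteq> bd" using \<rho>_only by (auto simp: N\<^sub>\<rho>_def bd_def J'_def)
  have N\<^sub>u_sub: "N\<^sub>u \<subseteq> M \<union> (J - {u})" using u by (auto simp: N\<^sub>u_def bd_def J'_def M_def)
  have cN\<^sub>u: "card (p ` N\<^sub>u) \<le> k" and cN\<^sub>\<rho>: "card (p ` N\<^sub>\<rho>) \<le> k"
  proof -
    have "card N\<^sub>u = k" "card N\<^sub>\<rho> = k"
      using u\<rho> deg_S[OF uS] deg_S[OF \<rho>S] by (simp_all add: N\<^sub>u_def N\<^sub>\<rho>_def)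
    then show "card (p ` N\<^sub>u) \<le> k" "card (p ` N\<^sub>\<rho>) \<le> k"
      using card_image_le[of N\<^sub>u p] card_image_le[of N\<^sub>\<rho> p] by (simp_all add: N\<^sub>u_def N\<^sub>\<rho>_def)
  qed
  have pN\<^sub>\<rho>: "p ` N\<^sub>\<rho> \<subseteq> C"
    by (rule order_trans[OF image_mono pM]) (use N\<^sub>\<rho>_bd in \<open>simp add: M_def le_supI2\<close>)
  have pN\<^sub>u: "p ` N\<^sub>u \<subseteq> C \<union> U"
  proof -
    have "p ` (M \<union> (J - {u})) \<subseteq> C \<union> U" unfolding image_Un using pM pJ by (rule Un_mono)
    then show ?thesis using image_mono[OF N\<^sub>u_sub, of p] by (rule order_trans[rotated])
  qed
  define Y\<^sub>u where "Y\<^sub>u = choices (p ` N\<^sub>u) used"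
  define Y\<^sub>\<rho> where "Y\<^sub>\<rho> = choices (p ` N\<^sub>\<rho>) used"
  have Y_U: "Y\<^sub>u \<subseteq> U" "Y\<^sub>\<rho> \<subseteq> U" by (auto simp: Y\<^sub>u_def Y\<^sub>\<rho>_def choices_def)
  have Y_used: "Y\<^sub>u \<inter> used = {}" "Y\<^sub>\<rho> \<inter> used = {}" by (auto simp: Y\<^sub>u_def Y\<^sub>\<rho>_def choices_def)
  have finY\<^sub>\<rho> [simp]: "finite Y\<^sub>\<rho>" using finite_subset[OF Y_U(2)] by simp
  have red_u: "\<And>y z. y \<in> Y\<^sub>u \<Longrightarrow> z \<in> N\<^sub>u \<Longrightarrow> (y, p z) \<notin> B"
    and red_\<rho>: "\<And>y z. y \<in> Y\<^sub>\<rho> \<Longrightarrow> z \<in> N\<^sub>\<rho> \<Longrightarrow> (y, p z) \<notin> B"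
    by (auto simp: Y\<^sub>u_def Y\<^sub>\<rho>_def choices_def)
  have cY\<^sub>u: "2 \<le> card Y\<^sub>u"
  proof -
    have fin: "finite (p ` N\<^sub>u)" by (simp add: N\<^sub>u_def)
    have "card (p ` N\<^sub>u \<inter> U) \<le> card (p ` N\<^sub>u)" using fin by (intro card_mono) auto
    moreover have "1 \<le> k * t" using k_pos t_pos by (simp add: Suc_le_eq)
    moreover have "k * t + ex + k + 1 \<le> card Y\<^sub>u + card (p ` N\<^sub>u \<inter> U)"
      unfolding Y\<^sub>u_def by (rule card_choices[OF pN\<^sub>u cN\<^sub>u used(1,2)])
    ultimately show ?thesis using cN\<^sub>u by linarith
  qed
  have cY\<^sub>\<rho>: "k * t + ex + k + 1 \<le> card Y\<^sub>\<rho>"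
  proof -
    have "p ` N\<^sub>\<rho> \<inter> U = {}" using pN\<^sub>\<rho> C_U(3) by blast
    moreover have "p ` N\<^sub>\<rho> \<subseteq> C \<union> U" using pN\<^sub>\<rho> by blast
    ultimately show ?thesis
      using card_choices[OF _ cN\<^sub>\<rho> used(1,2)] unfolding Y\<^sub>\<rho>_def by (metis add_0_right card.empty)
  qed
  define F where "F = C - p ` M"
  have cF: "b \<le> card F + card M"
  proof -
    have "card (p ` M) \<le> card M" by (simp add: card_image_le)
    moreover have "card F = b - card (p ` M)"
      unfolding F_def using pM by (simp add: card_Diff_subset card_C)
    ultimately show ?thesis by simp
  qed
  define Q where "Q = F \<union> Y\<^sub>\<rho>"
  have F_Y: "F \<inter> Y\<^sub>\<rho> = {}" using Y_U C_U(3) by (auto simp: F_def)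
  have finQ [simp]: "finite Q" by (simp add: Q_def F_def)
  have cQ: "b + 1 \<le> card Q"
  proof -
    have "card Q = card F + card Y\<^sub>\<rho>" unfolding Q_def using F_Y by (intro card_Un_disjoint) (auto simp: F_def)
    then show ?thesis using cF cY\<^sub>\<rho> M_le c_bd kt cJ by linarith
  qed
  have dom_im: "p ` (Y \<union> (J - {u})) \<subseteq> p ` M \<union> used" by (auto simp: Y_TM used_def)
  have apart: "A \<inter> I = {}" if "A \<subseteq> U" "A \<inter> used = {}" "I \<subseteq> p ` M \<union> used" for A I
  proof -
    have "A \<inter> p ` M = {}" using that(1) pM C_U(3) by (meson disjoint_iff subsetD)
    then show ?thesis using that(2,3) by blast
  qed
  have Yu_fresh: "Y\<^sub>u \<inter> p ` (Y \<union> (J - {u})) = {}"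
    using Y_U(1) Y_used(1) dom_im by (rule apart)
  have Q_fresh: "Q \<inter> p ` (Y \<union> (J - {u})) = {}"
  proof -
    have "F \<inter> used = {}" using used(3) C_U(3) by (auto simp: F_def)
    then have "F \<inter> (p ` M \<union> used) = {}" by (auto simp: F_def)
    then have "F \<inter> p ` (Y \<union> (J - {u})) = {}" using dom_im by (meson disjoint_iff subsetD)
    moreover have "Y\<^sub>\<rho> \<inter> p ` (Y \<union> (J - {u})) = {}" using Y_U(2) Y_used(2) dom_im by (rule apart)
    ultimately show ?thesis by (simp add: Q_def Int_Un_distrib2)
  qed
  have u_dom: "u \<notin> Y \<union> (J - {u})" and \<rho>_dom: "\<rho> \<notin> insert u (Y \<union> (J - {u}))"
    using YJ' u \<rho> by (auto simp: J'_def)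
  have dom: "insert \<rho> (insert u (Y \<union> (J - {u}))) = T \<union> M \<union> J'"
    using u by (auto simp: Y_TM J'_def)
  have NJ': "R `` J' \<subseteq> M \<union> J'" by (auto simp: M_def bd_def)
  have NT: "R `` T \<subseteq> T \<union> M" by (auto simp: M_def)
  \<comment> \<open>Otherwise \<open>u\<close> is placed at \<open>y\<close> and \<open>\<rho>\<close> at \<open>a\<close>.\<close>
  have blue: "(a, y) \<in> B" if a: "a \<in> Q" and y: "y \<in> Y\<^sub>u" and ay: "a \<noteq> y"
    and stuck: "\<not> (\<exists>T' f' D'. tree_state T' f' D' \<and> card T < card T')" for a y
  proof (rule ccontr)
    assume red: "(a, y) \<notin> B"
    define h where "h = p(u := y, \<rho> := a)"
    have hp: "h z = p z" if "z \<in> Y \<union> (J - {u})" for z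
      using that u_dom \<rho>_dom by (auto simp: h_def)
    have hu: "h u = y" and h\<rho>: "h \<rho> = a" using u \<rho> by (auto simp: h_def)
    have "inj_on (p(u := y)) (insert u (Y \<union> (J - {u})))"
      by (rule inj_on_fun_upd_insert[OF injp u_dom]) (use y Yu_fresh in blast)
    then have injh: "inj_on h (T \<union> M \<union> J')"
      unfolding h_def dom[symmetric]
    proof (rule inj_on_fun_upd_insert)
      show "\<rho> \<notin> insert u (Y \<union> (J - {u}))" by (rule \<rho>_dom)
      show "a \<notin> (p(u := y)) ` insert u (Y \<union> (J - {u}))" using a Q_fresh ay by auto
    qed
    have yU: "y \<in> U" using y Y_U by blast
    have hM: "h ` M \<subseteq> C"
    proof -
      have "h ` M = p ` M" by (intro image_cong refl hp) (simp add: Y_TM)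
      then show ?thesis using pM by simp
    qed
    have hTJ: "h ` (T \<union> J) \<subseteq> U"
    proof -
      have "h ` (T \<union> (J - {u})) = used"
        unfolding used_def by (intro image_cong refl hp) (auto simp: Y_TM)
      moreover have "T \<union> J = insert u (T \<union> (J - {u}))" using u by blast
      ultimately show ?thesis using used(3) yU hu by simp
    qed
    have edge_u: "(y, h z) \<notin> B" if "(u, z) \<in> R" for z
    proof (cases "z = \<rho>")
      case True
      then show ?thesis using red h\<rho> blue_sym[of y a] by simp
    next
      case False
      then have z: "z \<in> N\<^sub>u" using that by (simp add: N\<^sub>u_def)
      then have "z \<in> Y \<union> (J - {u})" using N\<^sub>u_sub by (auto simp: Y_TM)
      then show ?thesis using red_u[OF y z] hp by simp
    qed
    have edge: "(h v, h z) \<notin> B" if v: "v \<in> T \<union> J" and vz: "(v, z) \<in> R" for v z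
    proof -
      consider "v = u" | "v \<in> T" | "v \<in> J - {u}" using v by blast
      then show ?thesis
      proof cases
        case 1
        then show ?thesis using edge_u vz hu by simp
      next
        case 2
        then have "v \<in> Y" "z \<in> Y" using vz by (auto simp: Y_def X_def)
        then show ?thesis using p_edge_T[OF 2 vz] hp by simp
      next
        case 3
        have "z \<noteq> \<rho>" using 3 vz \<rho>_only[of v] adj_sym[of v \<rho>] by auto
        show ?thesis
        proof (cases "z = u")
          case True
          then have "(y, h v) \<notin> B" using edge_u[of v] vz adj_sym[of v u] by simp
          then show ?thesis using True hu blue_sym[of y "h v"] by simp
        next
          case False
          have "z \<in> M \<union> J'" using vz 3 NJ' by (auto simp: J'_def)
          then have "z \<in> Y \<union> (J - {u})" using False \<open>z \<noteq> \<rho>\<close> by (auto simp: Y_TM J'_def)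
          then show ?thesis using p_edge[OF 3 _ vz] hp 3 by simp
        qed
      qed
    qed
    show False
    proof (cases "a \<in> F")
      case True
      have NTJ: "R `` (T \<union> J) \<subseteq> T \<union> M \<union> J'" using NT NJ' by (auto simp: J'_def)
      have "placed (T \<union> J) h"
        unfolding placed_def
      proof (intro conjI ballI)
        show "T \<union> J \<subseteq> V" using TV JS S_V by blast
        show "inj_on h (T \<union> J \<union> R `` (T \<union> J))"
          by (rule inj_on_subset[OF injh]) (use NTJ in \<open>auto simp: J'_def\<close>)
        have "R `` (T \<union> J) - (T \<union> J) \<subseteq> insert \<rho> M" using NTJ by (auto simp: J'_def)
        moreover have "a \<in> C" using True by (simp add: F_def)
        ultimately show "h ` (R `` (T \<union> J) - (T \<union> J)) \<subseteq> C" using hM h\<rho> by auto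
        show "(h v, h z) \<notin> B" if "v \<in> T \<union> J" "z \<in> R `` {v}" for v z
          using edge[OF that(1)] that(2) by simp
      qed (rule hTJ)
      then show False using advance[OF subset_refl JK] stuck by blast
    next
      case False
      then have aY: "a \<in> Y\<^sub>\<rho>" using a by (simp add: Q_def)
      have NTJ: "R `` (T \<union> J') \<subseteq> T \<union> M \<union> J'" using NT NJ' by auto
      have edge_\<rho>: "(a, h z) \<notin> B" if "(\<rho>, z) \<in> R" for z
      proof (cases "z = u")
        case True
        then show ?thesis using red hu by simp
      next
        case False
        then have z: "z \<in> N\<^sub>\<rho>" using that by (simp add: N\<^sub>\<rho>_def)
        then have "z \<in> Y" using N\<^sub>\<rho>_bd by (auto simp: Y_def)
        then show ?thesis using red_\<rho>[OF aY z] hp by simp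
      qed
      have "placed (T \<union> J') h"
        unfolding placed_def
      proof (intro conjI ballI)
        show "T \<union> J' \<subseteq> V" using TV J'K KS S_V by blast
        show "inj_on h (T \<union> J' \<union> R `` (T \<union> J'))"
          by (rule inj_on_subset[OF injh]) (use NTJ in auto)
        have "R `` (T \<union> J') - (T \<union> J') \<subseteq> M" using NTJ by auto
        then show "h ` (R `` (T \<union> J') - (T \<union> J')) \<subseteq> C" using hM by blast
        show "h ` (T \<union> J') \<subseteq> U" using hTJ aY Y_U(2) h\<rho> by (auto simp: J'_def)
        show "(h v, h z) \<notin> B" if "v \<in> T \<union> J'" "z \<in> R `` {v}" for v z
          using edge[of v z] edge_\<rho>[of z] that h\<rho> by (auto simp: J'_def)
      qed
      then show False using advance[OF _ J'K] stuck unfolding J'_def by blast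
    qed
  qed
  show ?thesis
  proof (rule ccontr)
    assume stuck: "\<not> ?thesis"
    note blue = blue[OF _ _ _ stuck]
    have Q_W: "Q \<subseteq> W" using Y_U(2) C_U by (auto simp: Q_def F_def)
    have Yu_Q: "y \<in> Q" if y: "y \<in> Y\<^sub>u" for y
    proof (rule ccontr)
      assume yQ: "y \<notin> Q"
      have "(y, a) \<in> B" if "a \<in> Q" for a
        using blue[OF that y] that yQ blue_sym[of a y] by auto
      then have "Q \<subseteq> bnb y" using Q_W by blast
      then have "card Q \<le> card (bnb y)" by (rule card_mono[OF fin_bnb])
      also have "\<dots> \<le> b" using bnb_le y Y_U(1) C_U(2) by blast
      finally show False using cQ by simp
    qed
    obtain y1 y2 where y: "y1 \<in> Y\<^sub>u" "y2 \<in> Y\<^sub>u" "y1 \<noteq> y2"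
      using cY\<^sub>u by (metis card_2_iff' obtain_subset_with_card_n subset_iff)
    have "card {y1, y2} < card Q" using cQ b_ge y(3) by simp
    then have "\<not> Q \<subseteq> {y1, y2}" by (metis card_mono finite.emptyI finite_insert not_le)
    then obtain a where a: "a \<in> Q" "a \<noteq> y1" "a \<noteq> y2" by blast
    have "(y1, y2) \<in> B" "(a, y1) \<in> B" "(a, y2) \<in> B"
      using blue[of y1 y2] blue[of a y1] blue[of a y2] a y Yu_Q by auto
    moreover have "y1 \<in> W" "y2 \<in> W" "a \<in> W" using a y Yu_Q Q_W by auto
    ultimately show False using tf unfolding blue_triangle_free_def by blast
  qed
qed

theorem tight_case_embedding: "\<exists>h. red_embedding R V B W h"
proof (rule ccontr)
  assume no: "\<not> ?thesis"
  obtain T f where T: "placed T f" "T \<subseteq> S\<^sub>1" "card S\<^sub>1 + card H \<le> (k + 1) * card T + ex"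
    using hub_stage[OF no] by blast
  have N: "R `` X \<inter> S = {}" if "X \<subseteq> S\<^sub>1" for X using nbrs_S1[OF that] S_H(2) by blast
  have "tree_state T f S\<^sub>1"
    using T N[OF T(2)] N[OF subset_refl] S1_subset by (simp add: tree_state_def)
  then have start: "tree_state T (fst (f, S\<^sub>1)) (snd (f, S\<^sub>1))" by simp
  obtain T fD where st: "tree_state T (fst fD) (snd fD)"
    and max: "\<And>T' fD'. tree_state T' (fst fD') (snd fD') \<Longrightarrow> card T' \<le> card T"
  proof (rule ex_max_pair[of "\<lambda>T fD. tree_state T (fst fD) (snd fD)" T "(f, S\<^sub>1)" card "card S"])
    show "card T \<le> card S" if "tree_state T (fst fD) (snd fD)" for T fD
      using that by (intro card_mono) (auto simp: tree_state_def)
  qed (use start in auto)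
  have "placed T (fst fD)" using st by (simp add: tree_state_def)
  then have "card T < t" using placed_imp_embedding no by (meson not_le)
  then obtain T' f' D' where "tree_state T' f' D'" "card T < card T'"
    using tree_step[OF st _ no] by blast
  then show False using max[of T' "(f', D')"] by simp
qed

end

section \<open>Sidorenko's bound\<close>

context guest
begin

lemma card_R_ge_connected:
  assumes conn: "\<And>X. X \<subseteq> V \<Longrightarrow> X \<noteq> {} \<Longrightarrow> R `` X \<subseteq> X \<Longrightarrow> X = V" and V: "V \<noteq> {}"
  shows "2 * card V \<le> card R + 2"
proof -
  define P where "P X \<longleftrightarrow> X \<subseteq> V \<and> X \<noteq> {} \<and> 2 * card X \<le> card (R \<inter> X \<times> X) + 2" for X
  obtain v where "v \<in> V" using V by blast
  then have "P {v}" by (simp add: P_def)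
  then obtain X c where X: "P X" and max: "\<And>X' c'. P X' \<Longrightarrow> card X' \<le> card X"
  proof (rule ex_max_pair[of "\<lambda>X c. P X" "{v}" "()" card "card V"])
    show "card X \<le> card V" if "P X" for X
      using that finV by (simp add: P_def card_mono)
  qed blast
  have XV: "X \<subseteq> V" and X_ne: "X \<noteq> {}" and cX: "2 * card X \<le> card (R \<inter> X \<times> X) + 2"
    using X by (simp_all add: P_def)
  have finX [simp]: "finite X" using XV finV by (rule finite_subset)
  have "R `` X \<subseteq> X"
  proof (rule ccontr)
    assume "\<not> ?thesis"
    then obtain u z where uz: "u \<in> X" "(u, z) \<in> R" "z \<notin> X" by blast
    have "insert (u, z) (insert (z, u) (R \<inter> X \<times> X)) \<subseteq> R \<inter> insert z X \<times> insert z X"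
      using uz adj_sym[of u z] by auto
    then have "card (insert (u, z) (insert (z, u) (R \<inter> X \<times> X))) \<le> card (R \<inter> insert z X \<times> insert z X)"
      by (intro card_mono) (simp add: fin_R)
    moreover have "u \<noteq> z" using uz by blast
    ultimately have "card (R \<inter> X \<times> X) + 2 \<le> card (R \<inter> insert z X \<times> insert z X)"
      using uz(3) fin_R by simp
    then have "2 * card (insert z X) \<le> card (R \<inter> insert z X \<times> insert z X) + 2"
      using cX uz(3) by simp
    moreover have "z \<in> V" using uz(2) RV by blast
    ultimately have "P (insert z X)" using XV by (simp add: P_def)
    then have "card (insert z X) \<le> card X" by (rule max)
    then show False using uz(3) by simp
  qed
  then have "X = V" using conn XV X_ne by blast
  moreover have "R \<inter> V \<times> V = R" using RV by blast
  ultimately show ?thesis using cX by simp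
qed

end

locale guest_host = guest R V + host B W
  for R :: "('a \<times> 'a) set" and V :: "'a set" and B :: "('b \<times> 'b) set" and W :: "'b set"
begin

lemma add_vertex:
  assumes v: "v \<in> V" and f: "red_embedding (R \<inter> (V - {v}) \<times> (V - {v})) (V - {v}) B W f"
    and y: "y \<in> W" "y \<notin> f ` (V - {v})" "\<And>z. z \<in> R `` {v} \<Longrightarrow> (y, f z) \<notin> B"
  shows "red_embedding R V B W (f(v := y))"
proof -
  have inj: "inj_on f (V - {v})" and im: "f ` (V - {v}) \<subseteq> W"
    and edge: "\<And>a c. a \<in> V - {v} \<Longrightarrow> c \<in> V - {v} \<Longrightarrow> (a, c) \<in> R \<Longrightarrow> (f a, f c) \<notin> B"
    using f unfolding red_embedding_def by auto
  have V_eq: "V = insert v (V - {v})" using v by blast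
  have "inj_on (f(v := y)) (insert v (V - {v}))"
    by (rule inj_on_fun_upd_insert[OF inj _ y(2)]) simp
  then have "inj_on (f(v := y)) V" using V_eq by simp
  moreover have "(f(v := y)) ` V \<subseteq> W" using im y(1) by auto
  moreover have "((f(v := y)) a, (f(v := y)) c) \<notin> B" if ac: "a \<in> V" "c \<in> V" "(a, c) \<in> R" for a c
  proof -
    have "a \<noteq> c" using ac(3) by auto
    then consider "a = v" "c \<noteq> v" | "c = v" "a \<noteq> v" | "a \<in> V - {v}" "c \<in> V - {v}" using ac by blast
    then show ?thesis
    proof cases
      case 1
      then show ?thesis using y(3)[of c] ac(3) by simp
    next
      case 2
      then show ?thesis using y(3)[of a] ac(3) adj_sym[of v a] blue_sym[of y "f a"] by simp
    next
      case 3
      then show ?thesis using edge[OF 3 ac(3)] by simp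
    qed
  qed
  ultimately show ?thesis unfolding red_embedding_def by blast
qed

lemma extend_by_low_degree:
  assumes v: "v \<in> V" and f: "red_embedding (R \<inter> (V - {v}) \<times> (V - {v})) (V - {v}) B W f"
    and c: "\<And>y. y \<in> W \<Longrightarrow> card (bnb y) \<le> c" and room: "card (V - {v}) + c * deg v < card W"
  shows "\<exists>h. red_embedding R V B W h"
proof -
  have im: "f ` (V - {v}) \<subseteq> W" using f unfolding red_embedding_def by auto
  have "R `` {v} \<subseteq> V - {v}" using RV by auto
  then have Z: "f ` (R `` {v}) \<subseteq> W" using im by blast
  have "card (f ` (R `` {v})) \<le> deg v" by (simp add: card_image_le)
  then have "c * card (f ` (R `` {v})) \<le> c * deg v" by (rule mult_le_mono2)
  moreover have "card (f ` (V - {v})) \<le> card (V - {v})" using finV by (simp add: card_image_le)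
  ultimately have "card (f ` (V - {v})) + c * card (f ` (R `` {v})) < card W" using room by linarith
  moreover have "finite (f ` (V - {v}))" using finV by simp
  ultimately obtain y where y: "y \<in> W" "y \<notin> f ` (V - {v})" "\<And>z. z \<in> f ` (R `` {v}) \<Longrightarrow> (y, z) \<notin> B"
    using room_avoiding_blue[OF Z, of c "f ` (V - {v})"] c Z by blast
  have "red_embedding R V B W (f(v := y))" by (rule add_vertex[OF v f y(1,2)]) (use y(3) in blast)
  then show ?thesis by blast
qed

end

lemma red_embedding_disjoint_parts:
  assumes X: "X \<subseteq> V" "R `` X \<subseteq> X" and "sym R"
    and f: "red_embedding (R \<inter> X \<times> X) X B W f"
    and g: "red_embedding (R \<inter> (V - X) \<times> (V - X)) (V - X) B (W - f ` X) g"
  shows "red_embedding R V B W (\<lambda>v. if v \<in> X then f v else g v)" (is "red_embedding R V B W ?h")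
proof -
  have f1: "inj_on f X" "f ` X \<subseteq> W" and f2: "\<And>u v. u \<in> X \<Longrightarrow> v \<in> X \<Longrightarrow> (u, v) \<in> R \<Longrightarrow> (f u, f v) \<notin> B"
    using f unfolding red_embedding_def by auto
  have g1: "inj_on g (V - X)" "g ` (V - X) \<subseteq> W - f ` X"
    and g2: "\<And>u v. u \<in> V - X \<Longrightarrow> v \<in> V - X \<Longrightarrow> (u, v) \<in> R \<Longrightarrow> (g u, g v) \<notin> B"
    using g unfolding red_embedding_def by auto
  have hV: "?h ` X = f ` X" "?h ` (V - X) = g ` (V - X)" by auto
  have "inj_on ?h X" "inj_on ?h (V - X)" using f1(1) g1(1) by (simp_all add: inj_on_def)
  moreover have "?h ` X \<inter> ?h ` (V - X) = {}" unfolding hV using g1(2) by blast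
  ultimately have "inj_on ?h (X \<union> (V - X))" unfolding inj_on_Un by blast
  moreover have V_eq: "X \<union> (V - X) = V" using X(1) by blast
  ultimately have "inj_on ?h V" by simp
  moreover have "?h ` (X \<union> (V - X)) \<subseteq> W" unfolding image_Un hV using f1(2) g1(2) by blast
  then have "?h ` V \<subseteq> W" unfolding V_eq .
  moreover have "(?h u, ?h v) \<notin> B" if uv: "u \<in> V" "v \<in> V" "(u, v) \<in> R" for u v
  proof (cases "u \<in> X")
    case True
    then have "v \<in> X" using uv X(2) by blast
    then show ?thesis using True f2 uv by simp
  next
    case False
    have "(v, u) \<in> R" using uv(3) \<open>sym R\<close> by (simp add: sym_def)
    then have "v \<notin> X" using False X(2) by blast
    then show ?thesis using False g2 uv by simp
  qed
  ultimately show ?thesis unfolding red_embedding_def by blast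
qed

text \<open>
  Deleting a vertex of degree 1 may leave a single isolated vertex, hence the alternative
  \<open>card V \<le> 1\<close> in the induction.
\<close>

theorem triangle_free_red_embedding:
  fixes R :: "('a \<times> 'a) set" and B :: "('b \<times> 'b) set"
  assumes "guest R V" "host B W" "blue_triangle_free B W"
    and "(\<forall>v\<in>V. R `` {v} \<noteq> {}) \<or> card V \<le> 1" and "card R < card W"
  shows "\<exists>f. red_embedding R V B W f"
  using assms
proof (induction "card V" arbitrary: R V W rule: less_induct)
  case less
  interpret guest_host R V B W using less.prems(1,2) by (rule guest_host.intro)
  note tf = less.prems(3) and no_iso = less.prems(4) and cW = less.prems(5)
  have W_ne: "W \<noteq> {}" using cW by auto
  show ?case
  proof (cases "card V \<le> 1")
    case True
    then have eq: "u = v" if "u \<in> V" "v \<in> V" for u v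
      using that finV by (simp add: card_le_Suc0_iff_eq)
    have R_empty: "R = {}"
    proof (rule ccontr)
      assume "R \<noteq> {}"
      then obtain u v where "(u, v) \<in> R" by auto
      then show False using eq[of u v] RV by auto
    qed
    obtain y where "y \<in> W" using W_ne by blast
    moreover have "inj_on (\<lambda>_. y) V" using eq by (auto simp: inj_on_def)
    ultimately have "red_embedding R V B W (\<lambda>_. y)" by (auto simp: red_embedding_def R_empty)
    then show ?thesis by blast
  next
    case False
    then have V_ne: "V \<noteq> {}" and nbr: "\<And>v. v \<in> V \<Longrightarrow> R `` {v} \<noteq> {}" using no_iso by auto
    show ?thesis
    proof (cases "\<exists>X\<subseteq>V. X \<noteq> {} \<and> R `` X \<subseteq> X \<and> X \<noteq> V")
      case True
      then obtain X where X: "X \<subseteq> V" "X \<noteq> {}" "R `` X \<subseteq> X" "X \<noteq> V" by blast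
      define X' where "X' = V - X"
      have X'_closed: "R `` X' \<subseteq> X'"
      proof -
        have "v \<notin> X" if "u \<in> X'" "(u, v) \<in> R" for u v
          using that X(3) adj_sym[of u v] by (auto simp: X'_def)
        then show ?thesis using RV by (auto simp: X'_def)
      qed
      have finX: "finite X" "finite X'" using X(1) finV by (auto simp: X'_def intro: finite_subset)
      have "card X < card V" using X finV by (intro psubset_card_mono) auto
      have "card X' < card V" using X finV by (intro psubset_card_mono) (auto simp: X'_def)
      have R_split: "R = R \<inter> X \<times> X \<union> R \<inter> X' \<times> X'"
      proof -
        have "(u, v) \<in> X \<times> X \<union> X' \<times> X'" if "(u, v) \<in> R" for u v
        proof (cases "u \<in> X")
          case True
          then show ?thesis using that X(3) by blast
        next
          case False
          then have "u \<in> X'" using that RV by (auto simp: X'_def)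
          then show ?thesis using that X'_closed by blast
        qed
        then show ?thesis by auto
      qed
      moreover have "(R \<inter> X \<times> X) \<inter> (R \<inter> X' \<times> X') = {}" by (auto simp: X'_def)
      ultimately have cR: "card R = card (R \<inter> X \<times> X) + card (R \<inter> X' \<times> X')"
        using fin_R by (metis card_Un_disjoint finite_Int)
      have ge: "card X \<le> card (R \<inter> X \<times> X)"
      proof -
        have "1 \<le> card (R `` {v} \<inter> X)" if "v \<in> X" for v
        proof -
          have "R `` {v} \<inter> X = R `` {v}" using that X(3) by blast
          then show ?thesis using nbr[of v] that X(1) by (auto simp: Suc_le_eq card_gt_0_iff)
        qed
        then have "(\<Sum>v\<in>X. 1) \<le> (\<Sum>v\<in>X. card (R `` {v} \<inter> X))" by (rule sum_mono)
        then show ?thesis using card_relation_Times[of X X R] finX by simp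
      qed
      have nb: "\<forall>v\<in>X. (R \<inter> X \<times> X) `` {v} \<noteq> {}"
      proof
        fix v assume v: "v \<in> X"
        have "(R \<inter> X \<times> X) `` {v} = R `` {v}" using v X(3) by blast
        then show "(R \<inter> X \<times> X) `` {v} \<noteq> {}" using nbr[of v] v X(1) by blast
      qed
      have nb': "\<forall>v\<in>X'. (R \<inter> X' \<times> X') `` {v} \<noteq> {}"
      proof
        fix v assume v: "v \<in> X'"
        have "(R \<inter> X' \<times> X') `` {v} = R `` {v}" using v X'_closed by blast
        then show "(R \<inter> X' \<times> X') `` {v} \<noteq> {}" using nbr[of v] v by (simp add: X'_def)
      qed
      have "\<exists>f. red_embedding (R \<inter> X \<times> X) X B W f"
        using less.hyps[OF \<open>card X < card V\<close> guest_restrict[OF X(1)] less.prems(2) tf] nb cR cW by simp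
      then obtain f where f: "red_embedding (R \<inter> X \<times> X) X B W f" by blast
      define W' where "W' = W - f ` X"
      have "inj_on f X" "f ` X \<subseteq> W" using f by (auto simp: red_embedding_def)
      then have cW': "card W' = card W - card X"
        using finX by (simp add: W'_def card_Diff_subset card_image)
      have host': "host B W'" using finW symB irreflB by (simp add: host_def W'_def)
      have tf': "blue_triangle_free B W'" using tf by (auto simp: blue_triangle_free_def W'_def)
      have "X' \<subseteq> V" by (auto simp: X'_def)
      have "card (R \<inter> X' \<times> X') < card W'" using cW' cR cW ge by simp
      then have "\<exists>g. red_embedding (R \<inter> X' \<times> X') X' B W' g"
        using less.hyps[OF \<open>card X' < card V\<close> guest_restrict[OF \<open>X' \<subseteq> V\<close>] host' tf'] nb' by blast
      then obtain g where "red_embedding (R \<inter> X' \<times> X') X' B W' g" by blast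
      then have "red_embedding R V B W (\<lambda>v. if v \<in> X then f v else g v)"
        unfolding X'_def W'_def by (rule red_embedding_disjoint_parts[OF X(1,3) symR f])
      then show ?thesis by blast
    next
      case False
      then have conn: "\<And>X. X \<subseteq> V \<Longrightarrow> X \<noteq> {} \<Longrightarrow> R `` X \<subseteq> X \<Longrightarrow> X = V" by blast
      obtain x0 where "x0 \<in> W" using W_ne by blast
      then obtain x where x: "x \<in> W" and x_max: "\<And>y. y \<in> W \<Longrightarrow> card (bnb y) \<le> card (bnb x)"
      proof (rule ex_max_pair[of "\<lambda>y c. y \<in> W" x0 "()" "\<lambda>y. card (bnb y)" "card W"])
        show "card (bnb y) \<le> card W" if "y \<in> W" for y using finW by (intro card_mono) auto
      qed blast
      define b where "b = card (bnb x)"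
      have b_max: "card (bnb y) \<le> b" if "y \<in> W" for y using x_max[OF that] by (simp add: b_def)
      show ?thesis
      proof (cases "card V \<le> b")
        case True
        then obtain f where f: "f ` V \<subseteq> bnb x" "inj_on f V"
          using card_le_inj[OF finV, of "bnb x"] by (auto simp: b_def)
        have "(y, z) \<notin> B" if "y \<in> bnb x" "z \<in> bnb x" for y z
          using that tf x blue_sym[of x y] by (auto simp: blue_triangle_free_def)
        then have "red_embedding R V B W f" using f unfolding red_embedding_def by blast
        then show ?thesis by blast
      next
        case b_V: False
        obtain v where v: "v \<in> V" and v_min: "\<And>w. w \<in> V \<Longrightarrow> deg v \<le> deg w"
          using V_ne ex_has_least_nat[of "\<lambda>v. v \<in> V" _ deg] by blast
        define X where "X = V - {v}"
        have X_V: "X \<subseteq> V" by (auto simp: X_def)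
        have cX: "card X = card V - 1" "card X < card V" using v finV V_ne by (simp_all add: X_def card_gt_0_iff)
        have deg_v: "1 \<le> deg v" using nbr[OF v] by (simp add: Suc_le_eq card_gt_0_iff)
        have restr: "(R \<inter> X \<times> X) `` {w} = R `` {w} - {v}" if "w \<in> X" for w
          using that RV by (auto simp: X_def)
        have "(\<forall>w\<in>X. (R \<inter> X \<times> X) `` {w} \<noteq> {}) \<or> card X \<le> 1"
        proof (cases "deg v = 1")
          case False
          have "R `` {w} - {v} \<noteq> {}" if "w \<in> X" for w
          proof
            assume "R `` {w} - {v} = {}"
            then have "R `` {w} \<subseteq> {v}" by blast
            then have "deg w \<le> card {v}" by (intro card_mono) auto
            then show False using v_min[of w] that X_V False deg_v by auto
          qed
          then show ?thesis using restr by simp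
        next
          case True
          then obtain w where w: "R `` {v} = {w}" by (metis card_1_singletonE)
          show ?thesis
          proof (cases "R `` {w} \<subseteq> {v}")
            case True
            have "w \<in> V" using w RV by blast
            then have "V = {v, w}" using conn[of "{v, w}"] w True v by auto
            then have "X \<subseteq> {w}" by (auto simp: X_def)
            then have "card X \<le> card {w}" by (intro card_mono) auto
            then show ?thesis by simp
          next
            case False
            have "R `` {z} - {v} \<noteq> {}" if "z \<in> X" for z
            proof (cases "z = w")
              case True
              then show ?thesis using False by blast
            next
              case False
              then have "(z, v) \<notin> R" using w adj_sym[of z v] by blast
              then show ?thesis using nbr[of z] that X_V by blast
            qed
            then show ?thesis using restr by simp
          qed
        qed
        moreover have "card (R \<inter> X \<times> X) < card W"
          using cW card_mono[OF fin_R, of "R \<inter> X \<times> X"] by simp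
        ultimately have "\<exists>f. red_embedding (R \<inter> X \<times> X) X B W f"
          using less.hyps[OF cX(2) guest_restrict[OF X_V] less.prems(2) tf] by blast
        then obtain f where f: "red_embedding (R \<inter> X \<times> X) X B W f" by blast
        show ?thesis
        proof (cases "card X + b * deg v < card W")
          case True
          then show ?thesis using extend_by_low_degree[OF v f[unfolded X_def], of b] b_max by (simp add: X_def)
        next
          case False
          then have few: "card R + 2 \<le> card V + b * deg v" using cW cX v finV V_ne by linarith
          \<comment> \<open>For \<open>deg v = 1\<close> a connected guest has at least \<open>n - 1\<close> edges, which makes the host too large
            for the failure.\<close>
          have deg2: "2 \<le> deg v"
          proof (rule ccontr)
            assume "\<not> ?thesis"
            then have "deg v = 1" using deg_v by simp
            then show False using few b_V card_R_ge_connected[OF conn V_ne] by simp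
          qed
          define k where "k = deg v - 1"
          define t where "t = card V - b"
          define ex where "ex = card R - (k + 1) * card V"
          have k: "k + 1 = deg v" using deg2 by (simp add: k_def)
          have "(\<Sum>w\<in>V. k + 1) \<le> (\<Sum>w\<in>V. deg w)" using v_min unfolding k by (intro sum_mono)
          then have ex: "card R = (k + 1) * card V + ex"
            unfolding ex_def card_R_eq_sum_deg[symmetric] by (simp add: mult.commute)
          have bt: "b + t = card V" using b_V by (simp add: t_def)
          have "(k + 1) * card V = (k + 1) * b + (k + 1) * t" unfolding bt[symmetric] by (rule distrib_left)
          moreover have "b * deg v = (k + 1) * b" unfolding k by (rule mult.commute)
          ultimately have gap: "(k + 1) * t + ex + 2 \<le> card V" using few ex by linarith
          have "tight_case R V B W x k t ex b"
          proof (unfold_locales)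
            show "1 \<le> k" using deg2 by (simp add: k_def)
            show "k + 1 \<le> deg w" if "w \<in> V" for w using v_min[OF that] k by simp
            show "1 \<le> t" using b_V by (simp add: t_def)
            show "card (bnb x) = b" by (simp add: b_def)
          qed (fact tf ex cW x bt gap | rule conn b_max; assumption)+
          then show ?thesis by (rule tight_case.tight_case_embedding)
        qed
      qed
    qed
  qed
qed

section \<open>Larger blue cliques\<close>

definition blue_clique :: "('b \<times> 'b) set \<Rightarrow> 'b set \<Rightarrow> bool" where
  "blue_clique B K \<longleftrightarrow> (\<forall>x\<in>K. \<forall>y\<in>K. x \<noteq> y \<longrightarrow> (x, y) \<in> B)"

lemma triangle_free_if_no_blue_3_clique:
  assumes "irrefl B" "sym B" and no: "\<And>K. K \<subseteq> W \<Longrightarrow> card K = 3 \<Longrightarrow> \<not> blue_clique B K"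
  shows "blue_triangle_free B W"
  unfolding blue_triangle_free_def
proof (intro ballI impI notI)
  fix x y z assume W: "x \<in> W" "y \<in> W" "z \<in> W" and B: "(x, y) \<in> B" "(y, z) \<in> B" "(x, z) \<in> B"
  have "x \<noteq> y" "y \<noteq> z" "x \<noteq> z" using B assms(1) by (auto simp: irrefl_def)
  then have "card {x, y, z} = 3" by simp
  moreover have "blue_clique B {x, y, z}" using B assms(2) by (auto simp: blue_clique_def sym_def)
  ultimately show False using no[of "{x, y, z}"] W by blast
qed

context guest_host
begin

lemma embedding_of_degenerate:
  assumes degen: "\<And>X. X \<subseteq> V \<Longrightarrow> X \<noteq> {} \<Longrightarrow> \<exists>v\<in>X. card (R `` {v} \<inter> X) \<le> d"
    and c: "\<And>y. y \<in> W \<Longrightarrow> card (bnb y) \<le> c" and room: "card V + c * d \<le> card W"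
  shows "\<exists>h. red_embedding R V B W h"
proof -
  have "\<exists>h. red_embedding (R \<inter> X \<times> X) X B W h" if "X \<subseteq> V" for X
    using that
  proof (induction "card X" arbitrary: X rule: less_induct)
    case less
    show ?case
    proof (cases "X = {}")
      case True
      then show ?thesis by (auto simp: red_embedding_def)
    next
      case False
      interpret X: guest_host "R \<inter> X \<times> X" X B W
        using guest_restrict[OF less.prems] host_axioms by (rule guest_host.intro)
      obtain v where v: "v \<in> X" "card (R `` {v} \<inter> X) \<le> d" using degen[OF less.prems False] by blast
      have nbrs: "(R \<inter> X \<times> X) `` {v} = R `` {v} \<inter> X" using v(1) by auto
      have lt: "card (X - {v}) < card X" using v(1) X.finV by (simp add: card_gt_0_iff False)
      have "X - {v} \<subseteq> V" using less.prems by blast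
      then obtain f where "red_embedding (R \<inter> (X - {v}) \<times> (X - {v})) (X - {v}) B W f"
        using less.hyps[OF lt] by blast
      moreover have "R \<inter> (X - {v}) \<times> (X - {v}) = (R \<inter> X \<times> X) \<inter> (X - {v}) \<times> (X - {v})" by blast
      ultimately have f: "red_embedding ((R \<inter> X \<times> X) \<inter> (X - {v}) \<times> (X - {v})) (X - {v}) B W f" by simp
      have "card X \<le> card V" using less.prems finV by (simp add: card_mono)
      moreover have "c * card (R `` {v} \<inter> X) \<le> c * d" using v(2) by (rule mult_le_mono2)
      ultimately have "card (X - {v}) + c * card (R `` {v} \<inter> X) < card W" using lt room by linarith
      then show ?thesis using X.extend_by_low_degree[OF v(1) f, of c] c unfolding nbrs by blast
    qed
  qed
  moreover have "R \<inter> V \<times> V = R" using RV by blast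
  ultimately show ?thesis by force
qed

end

text \<open>
  \<open>d\<close> is the degeneracy. By minimality some \<open>X\<close> induces a graph of minimum degree at least \<open>d\<close>,
  so \<open>X\<close> has at least \<open>d + 1\<close> vertices; its degrees sum to at least \<open>d * card X\<close>, and each vertex
  outside \<open>X\<close> adds at least 1.
\<close>

lemma (in guest) degeneracy_bound:
  assumes nbr: "\<And>v. v \<in> V \<Longrightarrow> R `` {v} \<noteq> {}" and V: "V \<noteq> {}"
  obtains d where "1 \<le> d" "d + 1 \<le> card V" "card V + d * d \<le> card R + 1"
    "\<And>X. X \<subseteq> V \<Longrightarrow> X \<noteq> {} \<Longrightarrow> \<exists>v\<in>X. card (R `` {v} \<inter> X) \<le> d"
proof -
  define P where "P d \<longleftrightarrow> (\<forall>X\<subseteq>V. X \<noteq> {} \<longrightarrow> (\<exists>v\<in>X. card (R `` {v} \<inter> X) \<le> d))" for d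
  have "P (card V)"
    unfolding P_def
  proof (intro allI impI)
    fix X assume "X \<subseteq> V" "X \<noteq> {}"
    then obtain v where "v \<in> X" by blast
    moreover have "card (R `` {v} \<inter> X) \<le> card V"
      using nbrs_subset finV by (intro card_mono) blast+
    ultimately show "\<exists>v\<in>X. card (R `` {v} \<inter> X) \<le> card V" by blast
  qed
  define d where "d = (LEAST d. P d)"
  have Pd: "P d" unfolding d_def using \<open>P (card V)\<close> by (rule LeastI)
  have least: "\<not> P d'" if "d' < d" for d' using that unfolding d_def by (rule not_less_Least)
  have "d \<noteq> 0"
  proof
    assume "d = 0"
    then have "\<exists>v\<in>V. card (R `` {v} \<inter> V) \<le> 0" using Pd V unfolding P_def by blast
    then obtain v where v: "v \<in> V" "card (R `` {v} \<inter> V) = 0" by blast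
    have "R `` {v} \<inter> V = R `` {v}" using RV by blast
    then show False using v nbr by simp
  qed
  then have "\<not> P (d - 1)" by (intro least) simp
  then obtain X where X: "X \<subseteq> V" "X \<noteq> {}" and "\<And>v. v \<in> X \<Longrightarrow> \<not> card (R `` {v} \<inter> X) \<le> d - 1"
    unfolding P_def by blast
  then have X_deg: "d \<le> card (R `` {v} \<inter> X)" if "v \<in> X" for v using that by fastforce
  have finX: "finite X" using X(1) finV by (rule finite_subset)
  obtain v where v: "v \<in> X" using X(2) by blast
  have "d \<le> card (R `` {v} \<inter> X)" using X_deg[OF v] .
  also have "\<dots> \<le> card (X - {v})" using finX by (intro card_mono) auto
  also have "\<dots> = card X - 1" using v by simp
  finally have "d \<le> card X - 1" .
  moreover have "0 < card X" using v finX by (auto simp: card_gt_0_iff)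
  ultimately have cX: "d + 1 \<le> card X" by linarith
  have "card R = (\<Sum>v\<in>X. deg v) + (\<Sum>v\<in>V - X. deg v)"
    unfolding card_R_eq_sum_deg using sum.subset_diff[OF X(1) finV, of deg] by simp
  moreover have "card X * d \<le> (\<Sum>v\<in>X. deg v)"
  proof -
    have "d \<le> deg v" if "v \<in> X" for v
      using X_deg[OF that] card_mono[of "R `` {v}" "R `` {v} \<inter> X"] by simp
    then show ?thesis using sum_bounded_below[of X d deg] by simp
  qed
  moreover have "card (V - X) \<le> (\<Sum>v\<in>V - X. deg v)"
  proof -
    have "1 \<le> deg v" if "v \<in> V - X" for v
      using nbr[of v] that by (simp add: Suc_le_eq card_gt_0_iff)
    then show ?thesis using sum_bounded_below[of "V - X" 1 deg] by simp
  qed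
  moreover have "card V = card X + card (V - X)"
    using X(1) finV finX by (metis card_Diff_subset card_mono le_add_diff_inverse)
  moreover have "card X + d * d \<le> card X * d + 1"
  proof -
    obtain d' where d': "d = Suc d'" using \<open>d \<noteq> 0\<close> not0_implies_Suc by blast
    have "(d + 1) * d' \<le> card X * d'" using cX by (rule mult_le_mono1)
    then show ?thesis by (simp add: d' algebra_simps)
  qed
  ultimately have "card V + d * d \<le> card R + 1" by linarith
  moreover have "1 \<le> d" using \<open>d \<noteq> 0\<close> by simp
  moreover have "d + 1 \<le> card V" using cX card_mono[OF finV X(1)] by linarith
  ultimately show ?thesis using that[of d] Pd unfolding P_def by blast
qed

text \<open>
  \<open>(s - d) * s ^ j \<ge> (s - d) * s\<^sup>2 \<ge> (s - d) * (s + d) \<ge> n\<close>, where \<open>s + d \<le> s\<^sup>2\<close> because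
  \<open>d\<^sup>2 + d + 1 \<le> s\<^sup>2\<close>.
\<close>

lemma degenerate_arith:
  fixes s d n :: real
  assumes s: "1 \<le> s" and d: "1 \<le> d" "d + 1 \<le> n" and sq: "n + d\<^sup>2 \<le> s\<^sup>2" and j: "2 \<le> j"
  shows "n - d \<le> (s - d) * s ^ j"
proof -
  have "d\<^sup>2 < s\<^sup>2" using sq d by linarith
  then have ds: "d < s" using s by (simp add: power2_less_imp_less)
  have "s + d \<le> s\<^sup>2"
  proof (rule ccontr)
    assume *: "\<not> ?thesis"
    have "d\<^sup>2 + 1 < s" using * sq d by linarith
    moreover have "1 \<le> d\<^sup>2" using d(1) by simp
    ultimately have "2 \<le> s" by linarith
    then have "2 * s \<le> s * s" using s by (intro mult_right_mono) auto
    then show False using * ds by (simp add: power2_eq_square)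
  qed
  also have "s\<^sup>2 \<le> s ^ j" using j s by (intro power_increasing) auto
  finally have "(s - d) * (s + d) \<le> (s - d) * s ^ j" using ds by (intro mult_left_mono) auto
  moreover have "(s - d) * (s + d) = s\<^sup>2 - d\<^sup>2" by (simp add: power2_eq_square algebra_simps)
  ultimately show ?thesis using sq d by linarith
qed

text \<open>
  The strict bound with \<open>card W + 1\<close> says that \<open>card W\<close> is at least the integer part of the power; for
  \<open>m = 3\<close> it is \<open>card R < card W\<close>.
\<close>

theorem red_embedding_if_no_blue_clique:
  fixes R :: "('a \<times> 'a) set" and B :: "('b \<times> 'b) set" and m :: nat
  assumes guest: "guest R V" and nbr: "\<And>v. v \<in> V \<Longrightarrow> R `` {v} \<noteq> {}" and m: "3 \<le> m"
    and "host B W" and "\<And>K. K \<subseteq> W \<Longrightarrow> card K = m \<Longrightarrow> \<not> blue_clique B K"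
    and "sqrt (real (card R) + 1) ^ (m - 1) < real (card W) + 1"
  shows "\<exists>f. red_embedding R V B W f"
  using m assms(4-)
proof (induction m arbitrary: W rule: nat_induct_at_least)
  case base
  interpret guest_host R V B W using guest base(1) by (rule guest_host.intro)
  have "blue_triangle_free B W"
    using irreflB symB base(2) by (rule triangle_free_if_no_blue_3_clique)
  moreover have "card R < card W" using base(3) by simp
  ultimately show ?case
    using triangle_free_red_embedding[OF guest base(1)] nbr by blast
next
  case (Suc m)
  define s where "s = sqrt (real (card R) + 1)"
  have s: "1 \<le> s" "s\<^sup>2 = real (card R) + 1" by (simp_all add: s_def)
  interpret guest_host R V B W using guest Suc.prems(1) by (rule guest_host.intro)
  show ?case
  proof (cases "V = {} \<or> (\<exists>x\<in>W. s ^ (m - 1) < real (card (bnb x)) + 1)")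
    case True
    then consider "V = {}" | x where "x \<in> W" "s ^ (m - 1) < real (card (bnb x)) + 1" by blast
    then show ?thesis
    proof cases
      case 1
      then show ?thesis by (auto simp: red_embedding_def)
    next
      case 2
      have "\<not> blue_clique B K" if K: "K \<subseteq> bnb x" "card K = m" for K
      proof
        assume "blue_clique B K"
        then have "blue_clique B (insert x K)"
          using K(1) blue_sym by (fastforce simp: blue_clique_def)
        moreover have "x \<notin> K" "finite K" using K(1) finite_subset[OF K(1)] by auto
        then have "card (insert x K) = Suc m" using K(2) by simp
        moreover have "insert x K \<subseteq> W" using K(1) 2(1) by blast
        ultimately show False using Suc.prems(2) by blast
      qed
      moreover have "host B (bnb x)" using finW symB irreflB by (simp add: host_def)
      ultimately obtain f where "red_embedding R V B (bnb x) f"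
        using Suc.IH 2(2) unfolding s_def by blast
      then have "red_embedding R V B W f" by (auto simp: red_embedding_def)
      then show ?thesis by blast
    qed
  next
    case False
    then have V_ne: "V \<noteq> {}" and small: "\<And>x. x \<in> W \<Longrightarrow> real (card (bnb x)) + 1 \<le> s ^ (m - 1)"
      by (auto simp: not_less)
    obtain d where d: "1 \<le> d" "d + 1 \<le> card V" "card V + d * d \<le> card R + 1"
      and degen: "\<And>X. X \<subseteq> V \<Longrightarrow> X \<noteq> {} \<Longrightarrow> \<exists>v\<in>X. card (R `` {v} \<inter> X) \<le> d"
      using degeneracy_bound[OF nbr V_ne] by blast
    define c where "c = nat \<lfloor>s ^ (m - 1) - 1\<rfloor>"
    have s1: "1 \<le> s ^ (m - 1)" using s(1) by (rule one_le_power)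
    have c_le: "real c \<le> s ^ (m - 1) - 1" using s1 by (simp add: c_def)
    have c: "card (bnb y) \<le> c" if "y \<in> W" for y
    proof -
      have "real (card (bnb y)) \<le> s ^ (m - 1) - 1" using small[OF that] by linarith
      then show ?thesis unfolding c_def by (rule le_nat_floor)
    qed
    have "real (card V + d * d) \<le> real (card R + 1)" using d(3) by (simp only: of_nat_le_iff)
    then have "real (card V) + (real d)\<^sup>2 \<le> s\<^sup>2" using s(2) by (simp add: power2_eq_square)
    moreover have "real d + 1 \<le> real (card V)" using d(2) by linarith
    moreover have "2 \<le> m - 1" using Suc.hyps by simp
    ultimately have ar: "real (card V) - real d \<le> (s - real d) * s ^ (m - 1)"
      using degenerate_arith[of s "real d" "real (card V)" "m - 1"] s(1) d(1) by simp
    have "real c * real d \<le> (s ^ (m - 1) - 1) * real d" using c_le by (rule mult_right_mono) simp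
    moreover have "s ^ m = s * s ^ (m - 1)" using Suc.hyps by (simp add: power_eq_if)
    moreover have "s ^ m < real (card W) + 1" using Suc.prems(3) by (simp add: s_def)
    ultimately have "real (card V) + real c * real d < real (card W) + 1"
      using ar by (simp add: algebra_simps)
    then have "real (card V + c * d) < real (card W + 1)" by simp
    then have "card V + c * d \<le> card W" by linarith
    then show ?thesis using embedding_of_degenerate[OF degen c] by blast
  qed
qed

section \<open>The Ramsey number\<close>

definition adjacency :: "'a graph \<Rightarrow> ('a \<times> 'a) set" where
  "adjacency G = {(u, v). {u, v} \<in> edges G}"

lemma card_adjacency:
  assumes "finite_simple_graph G"
  shows "card (adjacency G) = 2 * card (edges G)"
proof -
  have E: "edges G \<subseteq> [verts G]\<^bsup>2\<^esup>" and finV: "finite (verts G)"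
    using assms by (auto simp: finite_simple_graph_def)
  have finE: "finite (edges G)" using E finV by (meson finite_imp_finite_nsets finite_subset)
  have two: "finite {(u, v). {u, v} = e} \<and> card {(u, v). {u, v} = e} = 2" if "e \<in> edges G" for e
  proof -
    have "e \<in> [verts G]\<^bsup>2\<^esup>" using that E by blast
    then obtain a b where e: "e = {a, b}" "a \<noteq> b" by (rule nsets2_E)
    have "{(u, v). {u, v} = e} = {(a, b), (b, a)}" by (auto simp: e doubleton_eq_iff)
    then show ?thesis using e(2) by simp
  qed
  have "adjacency G = (\<Union>e\<in>edges G. {(u, v). {u, v} = e})" by (auto simp: adjacency_def)
  also have "card \<dots> = (\<Sum>e\<in>edges G. card {(u, v). {u, v} = e})"
    using finE two by (intro card_UN_disjoint) auto
  also have "\<dots> = 2 * card (edges G)" using two by simp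
  finally show ?thesis .
qed

lemma guest_adjacency:
  assumes "finite_simple_graph G"
  shows "guest (adjacency G) (verts G)"
proof -
  have E: "edges G \<subseteq> [verts G]\<^bsup>2\<^esup>" and finV: "finite (verts G)"
    using assms by (auto simp: finite_simple_graph_def)
  have adj: "u \<in> verts G \<and> v \<in> verts G \<and> u \<noteq> v" if "{u, v} \<in> edges G" for u v
  proof -
    have "{u, v} \<in> [verts G]\<^bsup>2\<^esup>" using that E by blast
    then show ?thesis by simp
  qed
  show ?thesis
    unfolding guest_def adjacency_def
  proof (intro conjI)
    show "sym {(u, v). {u, v} \<in> edges G}" by (simp add: sym_def insert_commute)
    show "irrefl {(u, v). {u, v} \<in> edges G}" using adj by (force simp: irrefl_def)
  qed (use finV adj in auto)
qed

lemma red_copy_of_embedding: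
  assumes G: "finite_simple_graph G"
    and f: "red_embedding (adjacency G) (verts G) {(x, y). x \<noteq> y \<and> c {x, y} = Blue} {..<N} f"
  shows "\<exists>S. subgraph S (colour_class N c Red) \<and> isomorphic_graphs S G"
proof -
  have E: "edges G \<subseteq> [verts G]\<^bsup>2\<^esup>" and finV: "finite (verts G)"
    using G by (auto simp: finite_simple_graph_def)
  have inj: "inj_on f (verts G)" and im: "f ` verts G \<subseteq> {..<N}"
    and red: "\<And>u v. u \<in> verts G \<Longrightarrow> v \<in> verts G \<Longrightarrow> {u, v} \<in> edges G \<Longrightarrow> \<not> (f u \<noteq> f v \<and> c {f u, f v} = Blue)"
    using f by (auto simp: red_embedding_def adjacency_def)
  define S where "S = (f ` verts G, (`) f ` edges G)"
  have edge: "f ` e \<in> [f ` verts G]\<^bsup>2\<^esup> \<and> c (f ` e) = Red" if e: "e \<in> edges G" for e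
  proof -
    have "e \<in> [verts G]\<^bsup>2\<^esup>" using e E by blast
    then obtain u v where uv: "e = {u, v}" "u \<in> verts G" "v \<in> verts G" "u \<noteq> v" by (rule nsets2_E)
    have ne: "f u \<noteq> f v" using inj uv by (auto simp: inj_on_def)
    then have "c {f u, f v} \<noteq> Blue" using red[of u v] uv e by simp
    then have "c {f u, f v} = Red" by (cases "c {f u, f v}") auto
    then show ?thesis using uv ne by simp
  qed
  have "[f ` verts G]\<^bsup>2\<^esup> \<subseteq> [{..<N}]\<^bsup>2\<^esup>" using im by (rule nsets_mono)
  then have "subgraph S (colour_class N c Red)"
    using edge im finV
    by (auto simp: subgraph_def finite_simple_graph_def S_def colour_class_def complete_graph_def)
  moreover have "isomorphic_graphs S G"
    unfolding isomorphic_graphs_def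
  proof (intro exI[of _ "inv_into (verts G) f"] conjI ballI)
    show "bij_betw (inv_into (verts G) f) (verts S) (verts G)"
      using inj unfolding S_def fst_conv by (intro bij_betw_inv_into inj_on_imp_bij_betw)
    fix a b assume "a \<in> verts S" "b \<in> verts S"
    then obtain u v where uv: "a = f u" "b = f v" "u \<in> verts G" "v \<in> verts G" by (auto simp: S_def)
    have "{f u, f v} \<in> (`) f ` edges G \<longleftrightarrow> {u, v} \<in> edges G"
    proof
      assume "{f u, f v} \<in> (`) f ` edges G"
      then obtain e where e: "e \<in> edges G" "f ` e = f ` {u, v}" by auto
      have "e \<subseteq> verts G" using e(1) E by (auto simp: nsets_def)
      moreover have "{u, v} \<subseteq> verts G" using uv by blast
      ultimately have "e = {u, v}" using inj_on_image_eq_iff[OF inj] e(2) by metis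
      then show "{u, v} \<in> edges G" using e(1) by simp
    next
      assume "{u, v} \<in> edges G"
      then have "f ` {u, v} \<in> (`) f ` edges G" by (rule imageI)
      then show "{f u, f v} \<in> (`) f ` edges G" by simp
    qed
    then show "{a, b} \<in> edges S \<longleftrightarrow> {inv_into (verts G) f a, inv_into (verts G) f b} \<in> edges G"
      using uv inj by (simp add: S_def)
  qed
  ultimately show ?thesis by blast
qed

lemma blue_copy_of_clique:
  assumes K: "K \<subseteq> {..<N}" "card K = m" and blue: "blue_clique {(x, y). x \<noteq> y \<and> c {x, y} = Blue} K"
  shows "\<exists>S. subgraph S (colour_class N c Blue) \<and> isomorphic_graphs S (complete_graph m)"
proof (rule clique_imp_subgraph_copy[OF finite_simple_complete_graph])
  show "K \<subseteq> verts (colour_class N c Blue)" "finite K" "card K = card (verts (complete_graph m))"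
    using K finite_subset[OF K(1)] by (auto simp: colour_class_def complete_graph_def)
  show "clique K (edges (colour_class N c Blue))"
    using blue K(1) by (auto simp: clique_def blue_clique_def colour_class_def complete_graph_def)
qed

theorem lemma5:
  fixes G :: "'a graph" and l m :: nat
  assumes "finite_simple_graph G"
    and "card (edges G) = l"
    and "\<not> (\<exists>v. isolated_vertex G v)"
    and "m \<ge> 3"
  shows "real (ramsey_number G (complete_graph m)) \<le> (2 * real l + 1) powr ((real m - 1) / 2)"
proof -
  define s where "s = sqrt (2 * real l + 1) ^ (m - 1)"
  define N where "N = nat \<lfloor>s\<rfloor>"
  have "1 \<le> s" unfolding s_def by (intro one_le_power) simp
  then have N: "0 < N" "real N \<le> s" "s < real N + 1" unfolding N_def by linarith+
  have s_powr: "s = (2 * real l + 1) powr ((real m - 1) / 2)"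
  proof -
    have "s = ((2 * real l + 1) powr (1 / 2)) powr real (m - 1)"
      unfolding s_def by (subst powr_realpow) (simp_all add: powr_half_sqrt)
    also have "\<dots> = (2 * real l + 1) powr ((real m - 1) / 2)"
      using assms(4) by (simp add: powr_powr of_nat_diff)
    finally show ?thesis .
  qed
  have cR: "card (adjacency G) = 2 * l" using card_adjacency[OF assms(1)] assms(2) by simp
  have nbr: "adjacency G `` {v} \<noteq> {}" if v: "v \<in> verts G" for v
  proof -
    obtain e where e: "e \<in> edges G" "v \<in> e" using assms(3) v by (auto simp: isolated_vertex_def)
    have "e \<in> [verts G]\<^bsup>2\<^esup>" using e(1) assms(1) by (auto simp: finite_simple_graph_def)
    then obtain a b where "e = {a, b}" by (rule nsets2_E)
    then have "(v, a) \<in> adjacency G \<or> (v, b) \<in> adjacency G"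
      using e by (auto simp: adjacency_def insert_commute)
    then show ?thesis by blast
  qed
  have "ramsey_property G (complete_graph m) N"
    unfolding ramsey_property_def
  proof
    fix c :: "nat set \<Rightarrow> colour"
    let ?B = "{(x, y). x \<noteq> y \<and> c {x, y} = Blue}"
    show "(\<exists>S. subgraph S (colour_class N c Red) \<and> isomorphic_graphs S G) \<or>
      (\<exists>S. subgraph S (colour_class N c Blue) \<and> isomorphic_graphs S (complete_graph m))"
    proof (cases "\<exists>K\<subseteq>{..<N}. card K = m \<and> blue_clique ?B K")
      case True
      then show ?thesis using blue_copy_of_clique by blast
    next
      case False
      have "host ?B {..<N}" by (auto simp: host_def sym_def irrefl_def insert_commute)
      moreover have "sqrt (real (card (adjacency G)) + 1) ^ (m - 1) < real (card {..<N}) + 1"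
        using N(3) by (simp add: cR s_def)
      ultimately have "\<exists>f. red_embedding (adjacency G) (verts G) ?B {..<N} f"
        using red_embedding_if_no_blue_clique[OF guest_adjacency[OF assms(1)] nbr assms(4)] False
        by blast
      then show ?thesis using red_copy_of_embedding[OF assms(1)] by blast
    qed
  qed
  then have "ramsey_number G (complete_graph m) \<le> N"
    unfolding ramsey_number_def using N(1) by (intro Least_le) simp
  then have "real (ramsey_number G (complete_graph m)) \<le> real N" by simp
  with N(2) show ?thesis unfolding s_powr by simp
qed

end
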